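(* Let $G$ be a topological group and $f\in C(G)$. The following conditions are equivalent: (1) $f\in\mathrm{LE}(G)$. (2) $f=m_{v,\psi}$ for some continuous co-representation $h\colon G\to\mathrm{Iso}(V)$, $v\in V$ and $\psi\in V^*$, for a Banach space $V$, with the property that the weak$^*$ and the norm topologies coincide on the orbit $G\varphi$ of every $\varphi$ in the weak$^*$ closure $Y:=\mathrm{cl}_{w^*}(G\psi)$. Moreover, one can assume in (2) that $Y$ separates points of $V$.
   Context: $C(G)$ is the algebra of bounded continuous real valued functions on $G$. A $G$-space is a Tychonoff space with a continuous left action of $G$. A compact $G$-space $X$, with its unique compatible uniformity $\mu_X$, is LE (locally equicontinuous) if every $x_0\in X$ is a point of equicontinuity of the $G$-subspace $\mathrm{cl}(Gx_0)$, i.e. for every $\varepsilon\in\mu_X$ there is a neighborhood $O$ of $x_0$ such that $(gx_0,gx)\in\varepsilon$ for all $x\in O\cap\mathrm{cl}(Gx_0)$ and $g\in G$. $f\in C(G)$ belongs to $\mathrm{LE}(G)$ if $f=F\circ\nu$ for some compact LE $G$-space $X$, some continuous $G$-equivariant map $\nu\colon G\to X$ with dense image ($G$ acting on itself by left translations) and some continuous $F\colon X\to\mathbb{R}$. For a real Banach space $V$, $\mathrm{Iso}(V)$ is the group of linear surjective isometries of $V$ with the strong operator topology. A co-representation is a map $h\colon G\to\mathrm{Iso}(V)$ with $h(g_1g_2)=h(g_2)h(g_1)$; put $vg:=h(g)(v)$ (a right action). The dual left action of $G$ on $V^*$ is $(g\psi)(v):=\psi(vg)$, and $G\psi=\{g\psi: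 g\in G\}$. For $v\in V$, $\psi\in V^*$ the matrix coefficient is $m_{v,\psi}\colon G\to\mathbb{R}$, $m_{v,\psi}(g)=\psi(vg)=\langle v,g\psi\rangle$. *)

theory Defs
  imports "HOL-Analysis.Analysis"
begin

text \<open>
  A topological group is a type of class \<open>topological_group_add\<close>. The class is written
  additively but is not commutative: \<open>g + h\<close> is the product, \<open>0\<close> the unit and \<open>- g\<close> the
  inverse. No separation axiom is imposed on the group. The algebra $C(G)$ is the library type
  \<open>'g \<Rightarrow>\<^sub>C real\<close> of bounded continuous functions.
\<close>

section \<open>The uniformity of a compact space\<close>

definition uniformity_on :: "'x set \<Rightarrow> ('x \<times> 'x) set set \<Rightarrow> bool" where
  "uniformity_on S \<U> \<longleftrightarrow>
     \<U> \<noteq> {} \<and>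
     (\<forall>E\<in>\<U>. Id_on S \<subseteq> E \<and> E \<subseteq> S \<times> S) \<and>
     (\<forall>E\<in>\<U>. \<forall>E'. E \<subseteq> E' \<and> E' \<subseteq> S \<times> S \<longrightarrow> E' \<in> \<U>) \<and>
     (\<forall>E\<in>\<U>. \<forall>E'\<in>\<U>. E \<inter> E' \<in> \<U>) \<and>
     (\<forall>E\<in>\<U>. E\<inverse> \<in> \<U>) \<and>
     (\<forall>E\<in>\<U>. \<exists>D\<in>\<U>. D O D \<subseteq> E)"

definition compatible_uniformity :: "'x topology \<Rightarrow> ('x \<times> 'x) set set \<Rightarrow> bool" where
  "compatible_uniformity X \<U> \<longleftrightarrow>
     uniformity_on (topspace X) \<U> \<and>
     (\<forall>A. openin X A \<longleftrightarrow> A \<subseteq> topspace X \<and> (\<forall>x\<in>A. \<exists>E\<in>\<U>. E `` {x} \<subseteq> A))"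

text \<open>Existence and uniqueness, for compact Hausdorff spaces, are proved below as
  \<open>compact_Hausdorff_ex1_compatible_uniformity\<close>.\<close>

definition compact_uniformity :: "'x topology \<Rightarrow> ('x \<times> 'x) set set" where
  "compact_uniformity X = (THE \<U>. compatible_uniformity X \<U>)"

lemma uniformity_onD:
  assumes "uniformity_on S \<U>"
  shows "\<U> \<noteq> {}"
    and "\<forall>E\<in>\<U>. Id_on S \<subseteq> E \<and> E \<subseteq> S \<times> S"
    and "\<forall>E\<in>\<U>. \<forall>E'. E \<subseteq> E' \<and> E' \<subseteq> S \<times> S \<longrightarrow> E' \<in> \<U>"
    and "\<forall>E\<in>\<U>. \<forall>E'\<in>\<U>. E \<inter> E' \<in> \<U>"
    and "\<forall>E\<in>\<U>. E\<inverse> \<in> \<U>"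
    and "\<forall>E\<in>\<U>. \<exists>D\<in>\<U>. D O D \<subseteq> E"
  using assms unfolding uniformity_on_def by - (elim conjE, assumption)+

lemma openin_prod_topologyD:
  assumes "openin (prod_topology X Y) W" "(x, y) \<in> W"
  obtains P Q where "openin X P" "openin Y Q" "x \<in> P" "y \<in> Q" "P \<times> Q \<subseteq> W"
  using assms(1)[unfolded openin_prod_topology_alt, rule_format, OF assms(2)] by (elim exE conjE)

lemma compatible_uniformity_openin:
  assumes "compatible_uniformity X \<U>"
  shows "openin X A \<longleftrightarrow> A \<subseteq> topspace X \<and> (\<forall>x\<in>A. \<exists>E\<in>\<U>. E `` {x} \<subseteq> A)"
  using assms unfolding compatible_uniformity_def by (elim conjE allE)

lemma compatible_uniformity_nbhd:
  assumes U: "compatible_uniformity X \<U>" and E: "E \<in> \<U>" and x: "x \<in> topspace X"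
  obtains A where "openin X A" "x \<in> A" "A \<subseteq> E `` {x}"
proof -
  define A where "A = {y \<in> topspace X. \<exists>D\<in>\<U>. D `` {y} \<subseteq> E `` {x}}"
  have unif: "uniformity_on (topspace X) \<U>"
    using U by (simp add: compatible_uniformity_def)
  have "\<exists>D\<in>\<U>. D `` {y} \<subseteq> A" if y: "y \<in> A" for y
  proof -
    obtain D where D: "D \<in> \<U>" "D `` {y} \<subseteq> E `` {x}"
      using y by (auto simp: A_def)
    obtain D' where D': "D' \<in> \<U>" "D' O D' \<subseteq> D"
      using uniformity_onD(6)[OF unif] D(1) by blast
    have D'S: "D' \<subseteq> topspace X \<times> topspace X"
      using uniformity_onD(2)[OF unif] D'(1) by blast
    have "D' `` {y} \<subseteq> A"
    proof
      fix z assume z: "z \<in> D' `` {y}"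
      have "D' `` {z} \<subseteq> E `` {x}"
        using z D'(2) D(2) by blast
      then show "z \<in> A"
        using z D'S D'(1) unfolding A_def by blast
    qed
    then show ?thesis using D'(1) by blast
  qed
  then have "openin X A"
    unfolding compatible_uniformity_openin[OF U] by (auto simp: A_def)
  moreover have "x \<in> A"
    using E x unfolding A_def by blast
  moreover have "A \<subseteq> E `` {x}"
  proof
    fix y assume "y \<in> A"
    then obtain D where "y \<in> topspace X" "D \<in> \<U>" "D `` {y} \<subseteq> E `` {x}"
      by (auto simp: A_def)
    moreover have "(y, y) \<in> D"
      using uniformity_onD(2)[OF unif] calculation by blast
    ultimately show "y \<in> E `` {x}" by blast
  qed
  ultimately show thesis using that by blast
qed

lemma compatible_uniformity_eq:
  assumes X: "compact_space X" and U: "compatible_uniformity X \<U>"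
  shows "\<U> = {E. E \<subseteq> topspace X \<times> topspace X \<and>
                 (\<exists>W. openin (prod_topology X X) W \<and> Id_on (topspace X) \<subseteq> W \<and> W \<subseteq> E)}"
    (is "_ = ?N")
proof
  have unif: "uniformity_on (topspace X) \<U>"
    using U by (simp add: compatible_uniformity_def)
  note u = uniformity_onD[OF unif]
  have refl: "\<And>E x. E \<in> \<U> \<Longrightarrow> x \<in> topspace X \<Longrightarrow> (x, x) \<in> E"
    using u(2) by blast
  have sub: "\<And>E. E \<in> \<U> \<Longrightarrow> E \<subseteq> topspace X \<times> topspace X"
    using u(2) by blast
  have up: "\<And>E E'. E \<in> \<U> \<Longrightarrow> E \<subseteq> E' \<Longrightarrow> E' \<subseteq> topspace X \<times> topspace X \<Longrightarrow> E' \<in> \<U>"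
    using u(3) by blast
  have int: "\<And>E E'. E \<in> \<U> \<Longrightarrow> E' \<in> \<U> \<Longrightarrow> E \<inter> E' \<in> \<U>"
    using u(4) by blast
  have conv: "\<And>E. E \<in> \<U> \<Longrightarrow> E\<inverse> \<in> \<U>"
    using u(5) by blast
  have comp: "\<And>E. E \<in> \<U> \<Longrightarrow> \<exists>D\<in>\<U>. D O D \<subseteq> E"
    using u(6) by blast
  have ne: "\<U> \<noteq> {}"
    using u(1) .
  show "\<U> \<subseteq> ?N"
  proof
    fix E assume E: "E \<in> \<U>"
    obtain D where D: "D \<in> \<U>" "D O D \<subseteq> E" using comp E by blast
    define D' where "D' = D \<inter> D\<inverse>"
    have D': "D' \<in> \<U>" unfolding D'_def using D int conv by blast
    have "\<exists>A. openin X A \<and> x \<in> A \<and> A \<subseteq> D' `` {x}" if "x \<in> topspace X" for x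
      using compatible_uniformity_nbhd[OF U D' that] by metis
    then obtain A where A: "\<And>x. x \<in> topspace X \<Longrightarrow> openin X (A x) \<and> x \<in> A x \<and> A x \<subseteq> D' `` {x}"
      by metis
    define W where "W = (\<Union>x\<in>topspace X. A x \<times> A x)"
    have "openin (prod_topology X X) W"
      unfolding W_def using A by (auto intro!: openin_Union simp: openin_prod_Times_iff)
    moreover have "Id_on (topspace X) \<subseteq> W"
      unfolding W_def using A by blast
    moreover have "W \<subseteq> E"
      unfolding W_def using A D(2) unfolding D'_def by blast
    ultimately show "E \<in> ?N" using sub[OF E] by blast
  qed
  show "?N \<subseteq> \<U>"
  proof
    fix E assume "E \<in> ?N"
    then obtain W where ES: "E \<subseteq> topspace X \<times> topspace X"
      and W: "openin (prod_topology X X) W" "Id_on (topspace X) \<subseteq> W" "W \<subseteq> E" by blast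
    have "\<exists>D A. D \<in> \<U> \<and> openin X A \<and> x \<in> A \<and> A \<subseteq> D `` {x} \<and> (D O D) `` {x} \<times> (D O D) `` {x} \<subseteq> W"
      if x: "x \<in> topspace X" for x
    proof -
      have "(x, x) \<in> W" using W(2) x by blast
      then obtain P Q where P: "openin X P" "openin X Q" "x \<in> P" "x \<in> Q" "P \<times> Q \<subseteq> W"
        by (rule openin_prod_topologyD[OF W(1)])
      have "openin X (P \<inter> Q)" using P by (simp add: openin_Int)
      moreover have "x \<in> P \<inter> Q" using P by blast
      ultimately obtain E' where E': "E' \<in> \<U>" "E' `` {x} \<subseteq> P \<inter> Q"
        by (meson compatible_uniformity_openin[OF U])
      obtain D where D: "D \<in> \<U>" "D O D \<subseteq> E'" using comp E' by blast
      obtain A where "openin X A" "x \<in> A" "A \<subseteq> D `` {x}"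
        using compatible_uniformity_nbhd[OF U D(1) x] by metis
      moreover have "(D O D) `` {x} \<times> (D O D) `` {x} \<subseteq> W"
        using D(2) E'(2) P(5) by blast
      ultimately show ?thesis using D(1) by blast
    qed
    then obtain D A where DA: "\<And>x. x \<in> topspace X \<Longrightarrow> D x \<in> \<U> \<and> openin X (A x) \<and> x \<in> A x \<and>
        A x \<subseteq> D x `` {x} \<and> (D x O D x) `` {x} \<times> (D x O D x) `` {x} \<subseteq> W"
      by metis
    have "compactin X (topspace X)" using X by (simp add: compact_space_def)
    then obtain \<F> where F: "finite \<F>" "\<F> \<subseteq> A ` topspace X" "topspace X \<subseteq> \<Union>\<F>"
      using compactinD[of X "topspace X" "A ` topspace X"] DA by blast
    obtain T where T: "finite T" "T \<subseteq> topspace X" "topspace X \<subseteq> (\<Union>x\<in>T. A x)"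
      using F finite_subset_image[OF F(1,2)] by blast
    obtain E0 where E0: "E0 \<in> \<U>" using ne by blast
    define M where "M = E0 \<inter> (\<Inter>x\<in>T. D x)"
    have "E0 \<inter> (\<Inter>x\<in>T'. D x) \<in> \<U>" if "finite T'" "T' \<subseteq> topspace X" for T'
      using that
    proof (induction T' rule: finite_induct)
      case empty
      then show ?case using E0 by simp
    next
      case (insert x T')
      have "E0 \<inter> (\<Inter>x\<in>insert x T'. D x) = D x \<inter> (E0 \<inter> (\<Inter>x\<in>T'. D x))" by blast
      then show ?case using insert int DA by (metis insert_subset)
    qed
    then have M: "M \<in> \<U>" using T unfolding M_def by blast
    have "M \<subseteq> W"
    proof
      fix p assume p: "p \<in> M"
      obtain a b where ab: "p = (a, b)" by (cases p)
      have S: "a \<in> topspace X" "b \<in> topspace X" using sub[OF M] p ab by auto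
      obtain x where x: "x \<in> T" "a \<in> A x" using T(3) S by blast
      have xS: "x \<in> topspace X" using x T by blast
      have "(x, a) \<in> D x" using DA[OF xS] x by blast
      moreover have "(a, b) \<in> D x" using p ab x unfolding M_def by blast
      moreover have "(a, a) \<in> D x" using refl DA[OF xS] S by blast
      ultimately show "p \<in> W" using DA[OF xS] ab by blast
    qed
    then show "E \<in> \<U>" using up[OF M] W(3) ES by blast
  qed
qed

lemma compact_Hausdorff_compatible_uniformity:
  assumes X: "compact_space X" "Hausdorff_space X"
  shows "compatible_uniformity X {E. E \<subseteq> topspace X \<times> topspace X \<and>
           (\<exists>W. openin (prod_topology X X) W \<and> Id_on (topspace X) \<subseteq> W \<and> W \<subseteq> E)}"
    (is "compatible_uniformity X ?N")
proof -
  let ?S = "topspace X" and ?P = "prod_topology X X"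
  have top: "?S \<times> ?S \<in> ?N"
    using openin_topspace[of ?P] by (auto intro!: exI[of _ "?S \<times> ?S"])
  have int: "E \<inter> E' \<in> ?N" if EE': "E \<in> ?N" "E' \<in> ?N" for E E'
  proof -
    obtain W W' where "openin ?P W" "Id_on ?S \<subseteq> W" "W \<subseteq> E" "openin ?P W'" "Id_on ?S \<subseteq> W'" "W' \<subseteq> E'"
      using EE' by blast
    then have "openin ?P (W \<inter> W')" "Id_on ?S \<subseteq> W \<inter> W'" "W \<inter> W' \<subseteq> E \<inter> E'" by auto
    then show ?thesis using EE' by blast
  qed
  have conv: "E\<inverse> \<in> ?N" if E: "E \<in> ?N" for E
  proof -
    obtain W where W: "openin ?P W" "Id_on ?S \<subseteq> W" "W \<subseteq> E" using E by blast
    have "openin ?P (W\<inverse>)"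
      unfolding openin_prod_topology_alt
    proof (intro allI impI)
      fix x y assume "(x, y) \<in> W\<inverse>"
      then have "(y, x) \<in> W" by simp
      then obtain P Q where PQ: "openin X P" "openin X Q" "y \<in> P" "x \<in> Q" "P \<times> Q \<subseteq> W"
        by (rule openin_prod_topologyD[OF W(1)])
      have "Q \<times> P \<subseteq> W\<inverse>" using PQ(5) by auto
      with PQ show "\<exists>U V. openin X U \<and> openin X V \<and> x \<in> U \<and> y \<in> V \<and> U \<times> V \<subseteq> W\<inverse>"
        by (intro exI[of _ Q] exI[of _ P]) simp
    qed
    moreover have "Id_on ?S \<subseteq> W\<inverse>" "W\<inverse> \<subseteq> E\<inverse>" using W by auto
    ultimately show ?thesis using E by blast
  qed
  have comp: "\<exists>D\<in>?N. D O D \<subseteq> E" if E: "E \<in> ?N" for E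
  proof -
    obtain W where W: "openin ?P W" "Id_on ?S \<subseteq> W" "W \<subseteq> E" using E by blast
    have cr: "completely_regular_space X"
      using X compact_Hausdorff_or_regular_imp_normal_space normal_imp_completely_regular_space
      by blast
    define V where "V = (\<lambda>f::'a \<Rightarrow> real. \<lambda>r. {p \<in> ?S \<times> ?S. \<bar>f (fst p) - f (snd p)\<bar> < r})"
    define V' where "V' = (\<lambda>f::'a \<Rightarrow> real. {p \<in> ?S \<times> ?S. \<bar>f (fst p) - f (snd p)\<bar> > 1/2})"
    have cont: "continuous_map ?P euclideanreal (\<lambda>p. \<bar>f (fst p) - f (snd p)\<bar>)"
      if f: "continuous_map X euclideanreal f" for f
    proof -
      have "continuous_map ?P euclideanreal (\<lambda>p. f (fst p))"
        "continuous_map ?P euclideanreal (\<lambda>p. f (snd p))"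
        using continuous_map_compose[OF continuous_map_fst f] continuous_map_compose[OF continuous_map_snd f]
        by (auto simp: o_def)
      then show ?thesis
        by (intro continuous_map_real_abs continuous_map_diff)
    qed
    have openV: "openin ?P (V f r)" if "continuous_map X euclideanreal f" for f r
      using openin_continuous_map_preimage[OF cont[OF that], of "{..<r}"]
      by (simp add: V_def)
    have openV': "openin ?P (V' f)" if "continuous_map X euclideanreal f" for f
      using openin_continuous_map_preimage[OF cont[OF that], of "{1/2<..}"]
      by (simp add: V'_def)
    have sep: "\<exists>f. continuous_map X euclideanreal f \<and> p \<in> V' f" if p: "p \<in> ?S \<times> ?S - W" for p
    proof -
      obtain a b where p_eq: "p = (a, b)" by (cases p)
      then have ab: "p = (a, b)" "a \<in> ?S" "b \<in> ?S" "a \<noteq> b" using p W(2) by auto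
      have "closedin X {b}" using X ab by (simp add: closedin_Hausdorff_sing_eq)
      then obtain f where "continuous_map X euclideanreal f" "f a = 0" "f b = 1"
        using cr ab unfolding completely_regular_space_alt by (metis DiffI image_subset_iff insertCI singletonD singletonI)
      then show ?thesis using ab by (intro exI[of _ f]) (auto simp: V'_def)
    qed
    have K: "compactin ?P (?S \<times> ?S - W)"
      using X W(1) closedin_compact_space[of ?P "?S \<times> ?S - W"]
      by (simp add: compact_space_prod_topology closedin_diff flip: topspace_prod_topology)
    have cover: "?S \<times> ?S - W \<subseteq> \<Union>(V' ` {f. continuous_map X euclideanreal f})"
      using sep by blast
    obtain \<F> where F: "finite \<F>" "\<F> \<subseteq> V' ` {f. continuous_map X euclideanreal f}"
      "?S \<times> ?S - W \<subseteq> \<Union>\<F>"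
      using compactinD[OF K _ cover] openV' by (metis (no_types, lifting) imageE mem_Collect_eq)
    obtain T where T: "finite T" "T \<subseteq> {f. continuous_map X euclideanreal f}"
      "?S \<times> ?S - W \<subseteq> (\<Union>f\<in>T. V' f)"
      using F finite_subset_image[OF F(1,2)] by blast
    define D where "D = ?S \<times> ?S \<inter> (\<Inter>f\<in>T. V f (1/4))"
    have "openin ?P (?S \<times> ?S \<inter> (\<Inter>f\<in>T'. V f (1/4)))"
      if "finite T'" "T' \<subseteq> {f. continuous_map X euclideanreal f}" for T'
      using that
    proof (induction T' rule: finite_induct)
      case empty
      then show ?case using openin_topspace[of ?P] by simp
    next
      case (insert f T')
      have "?S \<times> ?S \<inter> (\<Inter>f\<in>insert f T'. V f (1/4)) = V f (1/4) \<inter> (?S \<times> ?S \<inter> (\<Inter>f\<in>T'. V f (1/4)))"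
        by blast
      then show ?case using insert openV by (simp add: openin_Int)
    qed
    then have "openin ?P D" unfolding D_def using T by blast
    moreover have "Id_on ?S \<subseteq> D" unfolding D_def V_def by auto
    moreover have "D \<subseteq> ?S \<times> ?S" unfolding D_def by blast
    moreover have "D O D \<subseteq> E"
    proof
      fix p assume "p \<in> D O D"
      then obtain a b c where p: "p = (a, c)" "(a, b) \<in> D" "(b, c) \<in> D" by blast
      have "p \<in> W"
      proof (rule ccontr)
        assume "p \<notin> W"
        then obtain f where f: "f \<in> T" "p \<in> V' f" using T(3) p unfolding D_def by blast
        then have "\<bar>f a - f b\<bar> < 1/4" "\<bar>f b - f c\<bar> < 1/4" "\<bar>f a - f c\<bar> > 1/2"
          using p unfolding D_def V_def V'_def by auto
        then show False by linarith
      qed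
      then show "p \<in> E" using W by blast
    qed
    ultimately show ?thesis by blast
  qed
  have "uniformity_on ?S ?N"
    unfolding uniformity_on_def
  proof (intro conjI)
    show "?N \<noteq> {}" using top by blast
    show "\<forall>E\<in>?N. Id_on ?S \<subseteq> E \<and> E \<subseteq> ?S \<times> ?S" by blast
    show "\<forall>E\<in>?N. \<forall>E'. E \<subseteq> E' \<and> E' \<subseteq> ?S \<times> ?S \<longrightarrow> E' \<in> ?N"
    proof (intro ballI allI impI)
      fix E E' assume E: "E \<in> ?N" and E': "E \<subseteq> E' \<and> E' \<subseteq> ?S \<times> ?S"
      obtain W where W: "openin ?P W" "Id_on ?S \<subseteq> W" "W \<subseteq> E" using E by blast
      have "W \<subseteq> E'" using W(3) E' by (meson subset_trans)
      with W E' show "E' \<in> ?N" by (intro CollectI conjI exI[of _ W]) simp_all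
    qed
    show "\<forall>E\<in>?N. \<forall>E'\<in>?N. E \<inter> E' \<in> ?N" by (intro ballI int)
    show "\<forall>E\<in>?N. E\<inverse> \<in> ?N" by (intro ballI conv)
    show "\<forall>E\<in>?N. \<exists>D\<in>?N. D O D \<subseteq> E" by (intro ballI comp)
  qed
  moreover have "openin X A \<longleftrightarrow> A \<subseteq> ?S \<and> (\<forall>x\<in>A. \<exists>E\<in>?N. E `` {x} \<subseteq> A)" for A
  proof (intro iffI conjI ballI)
    assume A: "openin X A"
    show "A \<subseteq> ?S" using openin_subset[OF A] .
    fix x assume x: "x \<in> A"
    have xS: "x \<in> ?S" using x openin_subset[OF A] by blast
    define W where "W = ?S \<times> ?S - {x} \<times> (?S - A)"
    have "closedin X {x}" using X xS by (simp add: closedin_Hausdorff_sing_eq)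
    then have "closedin ?P ({x} \<times> (?S - A))"
      using A by (simp add: closedin_prod_Times_iff closedin_diff)
    then have "openin ?P W"
      unfolding W_def using openin_diff[OF openin_topspace[of ?P]] by simp
    moreover have "Id_on ?S \<subseteq> W" using x unfolding W_def by blast
    ultimately have "W \<in> ?N" unfolding W_def by blast
    moreover have "W `` {x} \<subseteq> A" unfolding W_def by blast
    ultimately show "\<exists>E\<in>?N. E `` {x} \<subseteq> A" by blast
  next
    assume A: "A \<subseteq> ?S \<and> (\<forall>x\<in>A. \<exists>E\<in>?N. E `` {x} \<subseteq> A)"
    show "openin X A"
    proof (subst openin_subopen, intro ballI)
      fix x assume x: "x \<in> A"
      then obtain E where E: "E \<in> ?N" "E `` {x} \<subseteq> A" using A by meson
      then obtain W where W: "openin ?P W" "Id_on ?S \<subseteq> W" "W \<subseteq> E" by blast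
      then have WA: "W `` {x} \<subseteq> A" using E(2) by blast
      have "(x, x) \<in> W" using W(2) x A by blast
      then obtain P Q where PQ: "openin X P" "openin X Q" "x \<in> P" "x \<in> Q" "P \<times> Q \<subseteq> W"
        by (rule openin_prod_topologyD[OF W(1)])
      have "Q \<subseteq> A" using WA PQ(3,5) by blast
      with PQ show "\<exists>T. openin X T \<and> x \<in> T \<and> T \<subseteq> A" by (intro exI[of _ Q]) simp
    qed
  qed
  ultimately show ?thesis unfolding compatible_uniformity_def by (intro conjI allI)
qed

lemma compact_Hausdorff_ex1_compatible_uniformity:
  assumes "compact_space X" "Hausdorff_space X"
  shows "\<exists>!\<U>. compatible_uniformity X \<U>"
  by (rule ex1I, rule compact_Hausdorff_compatible_uniformity[OF assms],
      rule compatible_uniformity_eq[OF assms(1)])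

section \<open>Locally equicontinuous \<open>G\<close>-spaces and functions\<close>

definition G_space :: "'x topology \<Rightarrow> ('g::topological_group_add \<Rightarrow> 'x \<Rightarrow> 'x) \<Rightarrow> bool" where
  "G_space X act \<longleftrightarrow>
     completely_regular_space X \<and> Hausdorff_space X \<and>
     (\<forall>x\<in>topspace X. act 0 x = x) \<and>
     (\<forall>g h. \<forall>x\<in>topspace X. act (g + h) x = act g (act h x)) \<and>
     continuous_map (prod_topology euclidean X) X (\<lambda>(g, x). act g x)"

definition orbit_closure :: "'x topology \<Rightarrow> ('g \<Rightarrow> 'x \<Rightarrow> 'x) \<Rightarrow> 'x \<Rightarrow> 'x set" where
  "orbit_closure X act x = X closure_of (range (\<lambda>g. act g x))"

definition LE_G_space :: "'x topology \<Rightarrow> ('g::topological_group_add \<Rightarrow> 'x \<Rightarrow> 'x) \<Rightarrow> bool" where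
  "LE_G_space X act \<longleftrightarrow>
     compact_space X \<and> G_space X act \<and>
     (\<forall>x0\<in>topspace X. \<forall>\<epsilon>\<in>compact_uniformity X.
        \<exists>U. openin X U \<and> x0 \<in> U \<and>
            (\<forall>x \<in> U \<inter> orbit_closure X act x0. \<forall>g. (act g x0, act g x) \<in> \<epsilon>))"

definition LE_factorization ::
  "('g::topological_group_add \<Rightarrow>\<^sub>C real) \<Rightarrow> 'x topology \<Rightarrow> ('g \<Rightarrow> 'x \<Rightarrow> 'x) \<Rightarrow> ('g \<Rightarrow> 'x) \<Rightarrow> ('x \<Rightarrow> real) \<Rightarrow> bool"
where
  "LE_factorization f X act \<nu> F \<longleftrightarrow>
     LE_G_space X act \<and>
     continuous_map euclidean X \<nu> \<and> (\<forall>g h. \<nu> (g + h) = act g (\<nu> h)) \<and>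
     X closure_of (range \<nu>) = topspace X \<and>
     continuous_map X euclideanreal F \<and>
     apply_bcontfun f = F \<circ> \<nu>"

text \<open>
  HOL cannot quantify over all types, so \<open>X\<close> has to range over spaces carried by one fixed type.
  This is no restriction: since \<open>\<nu>\<close> has dense image, a point \<open>x\<close> of a compact Hausdorff \<open>X\<close> is
  determined by the functional sending \<open>F \<circ> \<nu>\<close> to \<open>F x\<close> (for \<open>F\<close> continuous on \<open>X\<close>)
  and every other element of $C(G)$ to \<open>0\<close>, so \<open>X\<close> has a copy carried by a set of real functions
  on $C(G)$.
\<close>

definition LE_functions :: "('g::topological_group_add \<Rightarrow>\<^sub>C real) set" where
  "LE_functions =
     {f. \<exists>(X :: (('g \<Rightarrow>\<^sub>C real) \<Rightarrow> real) topology) act \<nu> F. LE_factorization f X act \<nu> F}"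

section \<open>Banach spaces, duals and co-representations\<close>

text \<open>
  A Banach space is a pair \<open>(V, N)\<close>: a linear subspace \<open>V\<close> of a real vector space together with a
  complete norm \<open>N\<close> on \<open>V\<close>, unrelated to any norm or topology the ambient type may carry.
\<close>

text \<open>The value \<open>0\<close> off \<open>V\<close> is immaterial; the locale \<open>Metric_space\<close> requires distances to be
  nonnegative and symmetric on the whole type.\<close>

definition norm_dist :: "'v::real_vector set \<Rightarrow> ('v \<Rightarrow> real) \<Rightarrow> 'v \<Rightarrow> 'v \<Rightarrow> real" where
  "norm_dist V N v w = (if v \<in> V \<and> w \<in> V then N (v - w) else 0)"

definition banach_space_on :: "'v::real_vector set \<Rightarrow> ('v \<Rightarrow> real) \<Rightarrow> bool" where
  "banach_space_on V N \<longleftrightarrow>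
     subspace V \<and>
     (\<forall>v\<in>V. 0 \<le> N v \<and> (N v = 0 \<longleftrightarrow> v = 0)) \<and>
     (\<forall>c. \<forall>v\<in>V. N (c *\<^sub>R v) = \<bar>c\<bar> * N v) \<and>
     (\<forall>v\<in>V. \<forall>w\<in>V. N (v + w) \<le> N v + N w) \<and>
     Metric_space.mcomplete V (norm_dist V N)"

lemma Metric_space_norm_dist:
  assumes "banach_space_on V N"
  shows "Metric_space V (norm_dist V N)"
proof -
  have V: "subspace V" and pos: "\<And>v. v \<in> V \<Longrightarrow> 0 \<le> N v" and zero: "\<And>v. v \<in> V \<Longrightarrow> N v = 0 \<longleftrightarrow> v = 0"
    and scale: "\<And>c v. v \<in> V \<Longrightarrow> N (c *\<^sub>R v) = \<bar>c\<bar> * N v"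
    and tri: "\<And>v w. v \<in> V \<Longrightarrow> w \<in> V \<Longrightarrow> N (v + w) \<le> N v + N w"
    using assms unfolding banach_space_on_def by simp_all
  note diff = subspace_diff[OF V]
  show ?thesis
  proof
    fix v w u
    show "0 \<le> norm_dist V N v w" by (simp add: norm_dist_def pos diff)
    show "norm_dist V N v w = norm_dist V N w v"
      using scale[OF diff, of v w "-1"] by (simp add: norm_dist_def)
    show "norm_dist V N v w = 0 \<longleftrightarrow> v = w" if "v \<in> V" "w \<in> V"
      using that by (simp add: norm_dist_def zero diff)
    show "norm_dist V N v u \<le> norm_dist V N v w + norm_dist V N w u"
      if "v \<in> V" "w \<in> V" "u \<in> V"
      using tri[OF diff diff, of v w w u] that by (simp add: norm_dist_def)
  qed
qed

definition norm_topology :: "'v::real_vector set \<Rightarrow> ('v \<Rightarrow> real) \<Rightarrow> 'v topology" where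
  "norm_topology V N = Metric_space.mtopology V (norm_dist V N)"

definition linear_on_subspace :: "'v::real_vector set \<Rightarrow> ('v \<Rightarrow> 'w::real_vector) \<Rightarrow> bool" where
  "linear_on_subspace V T \<longleftrightarrow>
     (\<forall>v\<in>V. \<forall>w\<in>V. T (v + w) = T v + T w) \<and> (\<forall>c. \<forall>v\<in>V. T (c *\<^sub>R v) = c *\<^sub>R T v)"

text \<open>Functionals and operators on \<open>V\<close> are \<open>extensional\<close>, so that equality of functions is
  equality on \<open>V\<close>, and they are points of product topologies indexed by \<open>V\<close>.\<close>

definition dual :: "'v::real_vector set \<Rightarrow> ('v \<Rightarrow> real) \<Rightarrow> ('v \<Rightarrow> real) set" where
  "dual V N = {\<phi> \<in> extensional V. linear_on_subspace V \<phi> \<and> (\<exists>C. \<forall>v\<in>V. \<bar>\<phi> v\<bar> \<le> C * N v)}"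

definition dual_dist :: "'v::real_vector set \<Rightarrow> ('v \<Rightarrow> real) \<Rightarrow> ('v \<Rightarrow> real) \<Rightarrow> ('v \<Rightarrow> real) \<Rightarrow> real" where
  "dual_dist V N \<phi> \<theta> =
     (if \<phi> \<in> dual V N \<and> \<theta> \<in> dual V N then SUP v\<in>{v\<in>V. N v \<le> 1}. \<bar>\<phi> v - \<theta> v\<bar> else 0)"

lemma Metric_space_dual_dist:
  assumes "banach_space_on V N"
  shows "Metric_space (dual V N) (dual_dist V N)"
proof -
  have V: "subspace V" and pos: "\<And>v. v \<in> V \<Longrightarrow> 0 \<le> N v" and zero: "\<And>v. v \<in> V \<Longrightarrow> N v = 0 \<longleftrightarrow> v = 0"
    and scale: "\<And>c v. v \<in> V \<Longrightarrow> N (c *\<^sub>R v) = \<bar>c\<bar> * N v"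
    using assms unfolding banach_space_on_def by simp_all
  let ?B = "{v\<in>V. N v \<le> 1}"
  have 0: "0 \<in> ?B" using subspace_0[OF V] zero[of 0] by simp
  have bdd: "bdd_above ((\<lambda>v. \<bar>\<phi> v - \<theta> v\<bar>) ` ?B)"
    if \<phi>: "\<phi> \<in> dual V N" and \<theta>: "\<theta> \<in> dual V N" for \<phi> \<theta>
  proof -
    obtain C where C: "\<forall>v\<in>V. \<bar>\<phi> v\<bar> \<le> C * N v" using \<phi> by (auto simp: dual_def)
    obtain D where D: "\<forall>v\<in>V. \<bar>\<theta> v\<bar> \<le> D * N v" using \<theta> by (auto simp: dual_def)
    have "\<bar>\<phi> v - \<theta> v\<bar> \<le> \<bar>C\<bar> + \<bar>D\<bar>" if v: "v \<in> ?B" for v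
    proof -
      have "c * N v \<le> \<bar>c\<bar> * 1" for c
        using v pos[of v] by (intro mult_mono) auto
      then have "C * N v \<le> \<bar>C\<bar>" "D * N v \<le> \<bar>D\<bar>" by simp_all
      moreover have "\<bar>\<phi> v\<bar> \<le> C * N v" "\<bar>\<theta> v\<bar> \<le> D * N v" using v C D by auto
      ultimately show ?thesis by linarith
    qed
    then show ?thesis by (rule bdd_aboveI2)
  qed
  have upper: "\<bar>\<phi> v - \<theta> v\<bar> \<le> dual_dist V N \<phi> \<theta>"
    if "\<phi> \<in> dual V N" "\<theta> \<in> dual V N" "v \<in> ?B" for \<phi> \<theta> v
    using cSUP_upper[OF that(3) bdd[OF that(1,2)]] that(1,2) by (simp add: dual_dist_def)
  have least: "dual_dist V N \<phi> \<theta> \<le> r"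
    if "\<phi> \<in> dual V N" "\<theta> \<in> dual V N" "\<And>v. v \<in> ?B \<Longrightarrow> \<bar>\<phi> v - \<theta> v\<bar> \<le> r" for \<phi> \<theta> r
    unfolding dual_dist_def using that 0 by (auto intro!: cSUP_least)
  show ?thesis
  proof
    fix \<phi> \<theta> \<eta>
    show pos': "0 \<le> dual_dist V N \<phi> \<theta>"
      using upper[OF _ _ 0, of \<phi> \<theta>] abs_ge_zero order_trans
      by (cases "\<phi> \<in> dual V N \<and> \<theta> \<in> dual V N") (auto simp: dual_dist_def intro: order_trans)
    show "dual_dist V N \<phi> \<theta> = dual_dist V N \<theta> \<phi>"
      by (auto simp: dual_dist_def abs_minus_commute)
    show "dual_dist V N \<phi> \<theta> = 0 \<longleftrightarrow> \<phi> = \<theta>" if \<phi>: "\<phi> \<in> dual V N" and \<theta>: "\<theta> \<in> dual V N"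
    proof
      assume d: "dual_dist V N \<phi> \<theta> = 0"
      have "\<phi> v = \<theta> v" if v: "v \<in> V" for v
      proof (cases "v = 0")
        case True
        then show ?thesis using upper[OF \<phi> \<theta> 0] d by simp
      next
        case False
        then have N: "N v > 0" using pos[OF v] zero[OF v] by linarith
        have "inverse (N v) *\<^sub>R v \<in> ?B"
          using N v scale[OF v] subspace_scale[OF V v] by simp
        then have "\<phi> (inverse (N v) *\<^sub>R v) = \<theta> (inverse (N v) *\<^sub>R v)"
          using upper[OF \<phi> \<theta>] d by fastforce
        then show ?thesis
          using \<phi> \<theta> v N by (simp add: dual_def linear_on_subspace_def)
      qed
      then show "\<phi> = \<theta>"
        using \<phi> \<theta> by (auto simp: dual_def intro: extensionalityI)
    next
      assume "\<phi> = \<theta>"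
      then have "dual_dist V N \<phi> \<theta> \<le> 0" using \<phi> \<theta> by (intro least) auto
      with pos' show "dual_dist V N \<phi> \<theta> = 0" by simp
    qed
    show "dual_dist V N \<phi> \<eta> \<le> dual_dist V N \<phi> \<theta> + dual_dist V N \<theta> \<eta>"
      if "\<phi> \<in> dual V N" "\<theta> \<in> dual V N" "\<eta> \<in> dual V N"
    proof (rule least)
      fix v assume "v \<in> ?B"
      with upper[OF that(1,2)] upper[OF that(2,3)]
      show "\<bar>\<phi> v - \<eta> v\<bar> \<le> dual_dist V N \<phi> \<theta> + dual_dist V N \<theta> \<eta>" by fastforce
    qed (use that in auto)
  qed
qed

definition dual_norm_topology :: "'v::real_vector set \<Rightarrow> ('v \<Rightarrow> real) \<Rightarrow> ('v \<Rightarrow> real) topology" where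
  "dual_norm_topology V N = Metric_space.mtopology (dual V N) (dual_dist V N)"

definition weak_star_topology :: "'v::real_vector set \<Rightarrow> ('v \<Rightarrow> real) \<Rightarrow> ('v \<Rightarrow> real) topology" where
  "weak_star_topology V N = subtopology (product_topology (\<lambda>_. euclideanreal) V) (dual V N)"

definition Iso :: "'v::real_vector set \<Rightarrow> ('v \<Rightarrow> real) \<Rightarrow> ('v \<Rightarrow> 'v) set" where
  "Iso V N = {T \<in> extensional V. linear_on_subspace V T \<and> T ` V = V \<and> (\<forall>v\<in>V. N (T v) = N v)}"

definition strong_operator_topology :: "'v::real_vector set \<Rightarrow> ('v \<Rightarrow> real) \<Rightarrow> ('v \<Rightarrow> 'v) topology" where
  "strong_operator_topology V N = subtopology (product_topology (\<lambda>_. norm_topology V N) V) (Iso V N)"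

definition continuous_co_representation ::
  "'v::real_vector set \<Rightarrow> ('v \<Rightarrow> real) \<Rightarrow> ('g::topological_group_add \<Rightarrow> 'v \<Rightarrow> 'v) \<Rightarrow> bool"
where
  "continuous_co_representation V N h \<longleftrightarrow>
     (\<forall>g. h g \<in> Iso V N) \<and>
     (\<forall>g1 g2. h (g1 + g2) = compose V (h g2) (h g1)) \<and>
     continuous_map euclidean (strong_operator_topology V N) h"

definition matrix_coefficient ::
  "('g \<Rightarrow> 'v \<Rightarrow> 'v) \<Rightarrow> 'v \<Rightarrow> ('v \<Rightarrow> real) \<Rightarrow> 'g \<Rightarrow> real"
where
  "matrix_coefficient h v \<psi> g = \<psi> (h g v)"

definition dual_action :: "'v set \<Rightarrow> ('g \<Rightarrow> 'v \<Rightarrow> 'v) \<Rightarrow> 'g \<Rightarrow> ('v \<Rightarrow> real) \<Rightarrow> 'v \<Rightarrow> real" where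
  "dual_action V h g \<psi> = (\<lambda>v\<in>V. \<psi> (h g v))"

definition dual_orbit :: "'v set \<Rightarrow> ('g \<Rightarrow> 'v \<Rightarrow> 'v) \<Rightarrow> ('v \<Rightarrow> real) \<Rightarrow> ('v \<Rightarrow> real) set" where
  "dual_orbit V h \<psi> = range (\<lambda>g. dual_action V h g \<psi>)"

definition weak_star_orbit_closure ::
  "'v::real_vector set \<Rightarrow> ('v \<Rightarrow> real) \<Rightarrow> ('g \<Rightarrow> 'v \<Rightarrow> 'v) \<Rightarrow> ('v \<Rightarrow> real) \<Rightarrow> ('v \<Rightarrow> real) set"
where
  "weak_star_orbit_closure V N h \<psi> = weak_star_topology V N closure_of dual_orbit V h \<psi>"

text \<open>
  When this is quantified existentially, \<open>V\<close> has to be carried by one fixed type; linear subspaces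
  of $C(G)$ suffice. Dividing \<open>V\<close> by the common kernel of the functionals in the weak-star
  orbit closure of \<open>\<psi>\<close> makes \<open>v \<mapsto> matrix_coefficient h v \<psi>\<close> an injective linear map into
  $C(G)$, along which the norm is transported.
\<close>

definition LE_matrix_coefficient ::
  "('g::topological_group_add \<Rightarrow>\<^sub>C real) \<Rightarrow> 'v::real_vector set \<Rightarrow> ('v \<Rightarrow> real) \<Rightarrow>
     ('g \<Rightarrow> 'v \<Rightarrow> 'v) \<Rightarrow> 'v \<Rightarrow> ('v \<Rightarrow> real) \<Rightarrow> bool"
where
  "LE_matrix_coefficient f V N h v \<psi> \<longleftrightarrow>
     banach_space_on V N \<and> continuous_co_representation V N h \<and> v \<in> V \<and> \<psi> \<in> dual V N \<and>
     apply_bcontfun f = matrix_coefficient h v \<psi> \<and>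
     (\<forall>\<phi> \<in> weak_star_orbit_closure V N h \<psi>.
        subtopology (weak_star_topology V N) (dual_orbit V h \<phi>) =
        subtopology (dual_norm_topology V N) (dual_orbit V h \<phi>))"

definition separates_points :: "('v \<Rightarrow> real) set \<Rightarrow> 'v set \<Rightarrow> bool" where
  "separates_points Y V \<longleftrightarrow> (\<forall>v\<in>V. \<forall>w\<in>V. v \<noteq> w \<longrightarrow> (\<exists>\<phi>\<in>Y. \<phi> v \<noteq> \<phi> w))"

end

(* Let rho(x,y) be the supremum over g of |F(gx) - F(gy)|. Local equicontinuity says that rho is
   continuous at x along the orbit closure of x. The space V consists of the functions v on G that
   extend continuously to X and are Hoelder-1/2 there with respect to the invariant pseudometric rho,
   with translates depending norm-continuously on g. It is a Banach space under the Hoelder norm,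
   evaluations at points x and y have dual distance at most the square root of rho(x,y), and psi is
   evaluation at the unit.
   Conversely, the weak-star closure Y of the orbit of psi is a compact G-space; coincidence of the
   two topologies on an orbit makes it equicontinuous there, since the action is isometric for the
   dual norm and norm balls are weak-star closed.
   In the first direction V consists of functions on G, and in the second X consists of functions
   on V, so passing back and forth also moves X and V from arbitrary types to the prescribed ones. *)
theory Submission
  imports Defs
begin

section \<open>Duals of Banach spaces\<close>

text \<open>The norm on \<open>V\<close> must meet two opposing demands. Under the sup norm on all
  of \<open>CX\<close>, evaluations at distinct points have distance 2, so orbits would be norm
  discrete. Under a Lipschitz norm for \<rho>, evaluations at \<rho>-close points are close, but
  translates of \<open>f\<close> need not depend norm-continuously on the group element (a function
  with a kink on the circle, under rotations). Any exponent strictly between 0 and 1 meets both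
  demands; with 1/2, two bounds s and t on one quantity interpolate to \<open>sqrt (s * t)\<close>.
  The second obstacle is that the evaluation map \<open>q\<close> from X to the dual is not
  injective. A weak star neighbourhood of \<open>q x0\<close> pulls back to a neighbourhood of the
  whole fibre, while at another point y of the fibre equicontinuity is available only along cl(Gy),
  possibly smaller than cl(Gx0). Zorn's lemma yields a point x of the same fibre whose orbit closure
  C is minimal among those meeting the fibre. Every fibre point in C then has orbit closure C, and
  the dual orbits of \<open>q x\<close> and \<open>q x0\<close> are the same, so x may replace
  x0.\<close>

lemma continuous_map_real_iff:
  "continuous_map X euclideanreal k \<longleftrightarrow>
     (\<forall>x\<in>topspace X. \<forall>e>0. \<exists>U. openin X U \<and> x \<in> U \<and> (\<forall>y\<in>U. \<bar>k y - k x\<bar> < e))"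
  using Met_TC.continuous_map_to_metric[of X k]
  by (simp add: dist_real_def abs_minus_commute)

text \<open>Carries closed conditions from a set to its closure: linearity and bounds in
  \<open>Banach_Alaoglu\<close>, the uniform bound on the orbit closure, uniqueness of extensions
  from the dense image of \<nu>.\<close>

lemma continuous_map_closure_of_in_closed:
  assumes k: "continuous_map X euclideanreal k" and T: "closed T"
    and S: "\<And>s. s \<in> S \<Longrightarrow> k s \<in> T" and x: "x \<in> X closure_of S"
  shows "k x \<in> T"
proof -
  have "closedin X {y \<in> topspace X. k y \<in> T}"
    using closedin_continuous_map_preimage[OF k] T by simp
  then have "X closure_of (topspace X \<inter> S) \<subseteq> {y \<in> topspace X. k y \<in> T}"
    by (intro closure_of_minimal) (use S in auto)
  then show ?thesis using x closure_of_restrict[of X S] by auto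
qed

lemma compact_uniformity_eq:
  assumes "compact_space X" "Hausdorff_space X"
  shows "compact_uniformity X = {E. E \<subseteq> topspace X \<times> topspace X \<and>
           (\<exists>W. openin (prod_topology X X) W \<and> Id_on (topspace X) \<subseteq> W \<and> W \<subseteq> E)}"
  unfolding compact_uniformity_def
  by (rule the1_equality[OF compact_Hausdorff_ex1_compatible_uniformity[OF assms]
        compact_Hausdorff_compatible_uniformity[OF assms]])

locale banach =
  fixes V :: "'v::real_vector set" and N :: "'v \<Rightarrow> real"
  assumes banach: "banach_space_on V N"
begin

lemma subspace_V: "subspace V"
  and N_nonneg: "v \<in> V \<Longrightarrow> 0 \<le> N v"
  and N_eq_0: "v \<in> V \<Longrightarrow> N v = 0 \<longleftrightarrow> v = 0"
  and N_scale: "v \<in> V \<Longrightarrow> N (c *\<^sub>R v) = \<bar>c\<bar> * N v"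
  using banach unfolding banach_space_on_def by simp_all

lemmas V_0 = subspace_0[OF subspace_V] and V_add = subspace_add[OF subspace_V]
  and V_diff = subspace_diff[OF subspace_V] and V_scale = subspace_scale[OF subspace_V]

lemma N_0: "N 0 = 0"
  using N_eq_0[OF V_0] by simp

interpretation DM: Metric_space "dual V N" "dual_dist V N"
  by (rule Metric_space_dual_dist[OF banach])

lemma dual_extensional: "\<phi> \<in> dual V N \<Longrightarrow> \<phi> \<in> extensional V"
  and dual_add: "\<phi> \<in> dual V N \<Longrightarrow> v \<in> V \<Longrightarrow> w \<in> V \<Longrightarrow> \<phi> (v + w) = \<phi> v + \<phi> w"
  and dual_scale: "\<phi> \<in> dual V N \<Longrightarrow> v \<in> V \<Longrightarrow> \<phi> (c *\<^sub>R v) = c * \<phi> v"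
  unfolding dual_def linear_on_subspace_def by simp_all

lemma dual_diff: "\<phi> \<in> dual V N \<Longrightarrow> v \<in> V \<Longrightarrow> w \<in> V \<Longrightarrow> \<phi> (v - w) = \<phi> v - \<phi> w"
  using dual_add[of \<phi> v "(-1) *\<^sub>R w"] dual_scale[of \<phi> w "-1"] V_scale[of w "-1"] by simp

lemma dualI:
  assumes "\<phi> \<in> extensional V" "\<And>v w. v \<in> V \<Longrightarrow> w \<in> V \<Longrightarrow> \<phi> (v + w) = \<phi> v + \<phi> w"
    "\<And>c v. v \<in> V \<Longrightarrow> \<phi> (c *\<^sub>R v) = c * \<phi> v" "\<And>v. v \<in> V \<Longrightarrow> \<bar>\<phi> v\<bar> \<le> C * N v"
  shows "\<phi> \<in> dual V N"
  using assms unfolding dual_def linear_on_subspace_def by (auto intro!: exI[of _ C])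

lemma dual_bound:
  assumes "\<phi> \<in> dual V N"
  obtains C where "C \<ge> 0" "\<And>v. v \<in> V \<Longrightarrow> \<bar>\<phi> v\<bar> \<le> C * N v"
proof -
  obtain C where C: "\<And>v. v \<in> V \<Longrightarrow> \<bar>\<phi> v\<bar> \<le> C * N v"
    using assms by (auto simp: dual_def)
  have "\<bar>\<phi> v\<bar> \<le> \<bar>C\<bar> * N v" if "v \<in> V" for v
    using C[OF that] mult_right_mono[OF abs_ge_self N_nonneg[OF that], of C] by linarith
  then show thesis using that[of "\<bar>C\<bar>"] by simp
qed

lemma dual_dist_leI:
  assumes "\<phi> \<in> dual V N" "\<theta> \<in> dual V N"
    and "\<And>v. v \<in> V \<Longrightarrow> N v \<le> 1 \<Longrightarrow> \<bar>\<phi> v - \<theta> v\<bar> \<le> r"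
  shows "dual_dist V N \<phi> \<theta> \<le> r"
  unfolding dual_dist_def using assms V_0 N_0 by (auto intro!: cSUP_least exI[of _ 0])

lemma dual_dist_ge:
  assumes \<phi>: "\<phi> \<in> dual V N" and \<theta>: "\<theta> \<in> dual V N" and v: "v \<in> V" "N v \<le> 1"
  shows "\<bar>\<phi> v - \<theta> v\<bar> \<le> dual_dist V N \<phi> \<theta>"
proof -
  obtain C D where CD: "C \<ge> 0" "D \<ge> 0" "\<And>v. v \<in> V \<Longrightarrow> \<bar>\<phi> v\<bar> \<le> C * N v"
    "\<And>v. v \<in> V \<Longrightarrow> \<bar>\<theta> v\<bar> \<le> D * N v"
    using dual_bound[OF \<phi>] dual_bound[OF \<theta>] by metis
  have "\<bar>\<phi> v - \<theta> v\<bar> \<le> C + D" if v: "v \<in> V" "N v \<le> 1" for v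
  proof -
    have "C * N v \<le> C" "D * N v \<le> D"
      using v CD by (simp_all add: mult_left_le)
    then show ?thesis using CD(3)[OF v(1)] CD(4)[OF v(1)] by linarith
  qed
  then have "bdd_above ((\<lambda>v. \<bar>\<phi> v - \<theta> v\<bar>) ` {v \<in> V. N v \<le> 1})"
    by (intro bdd_aboveI2[of _ _ "C + D"]) auto
  then show ?thesis
    using cSUP_upper[of v "{v \<in> V. N v \<le> 1}" "\<lambda>v. \<bar>\<phi> v - \<theta> v\<bar>"] v \<phi> \<theta>
    by (simp add: dual_dist_def)
qed

lemma dual_dist_ge_mult:
  assumes \<phi>: "\<phi> \<in> dual V N" and \<theta>: "\<theta> \<in> dual V N" and v: "v \<in> V"
  shows "\<bar>\<phi> v - \<theta> v\<bar> \<le> dual_dist V N \<phi> \<theta> * N v"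
proof (cases "v = 0")
  case True
  then show ?thesis using dual_scale[OF \<phi> V_0, of 0] dual_scale[OF \<theta> V_0, of 0] N_0 by simp
next
  case False
  then have N: "N v > 0" using N_nonneg[OF v] N_eq_0[OF v] by linarith
  have "\<bar>\<phi> (inverse (N v) *\<^sub>R v) - \<theta> (inverse (N v) *\<^sub>R v)\<bar> \<le> dual_dist V N \<phi> \<theta>"
    using N v by (intro dual_dist_ge[OF \<phi> \<theta>] V_scale) (auto simp: N_scale)
  then have "\<bar>inverse (N v) * (\<phi> v - \<theta> v)\<bar> \<le> dual_dist V N \<phi> \<theta>"
    using v \<phi> \<theta> by (simp add: dual_scale algebra_simps)
  then show ?thesis using N by (simp add: abs_mult field_simps)
qed

lemma topspace_weak_star [simp]: "topspace (weak_star_topology V N) = dual V N"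
  unfolding weak_star_topology_def using dual_extensional
  by (auto simp: topspace_subtopology topspace_product_topology PiE_def)

lemma continuous_map_weak_star_iff:
  "continuous_map Z (weak_star_topology V N) q \<longleftrightarrow>
     q \<in> topspace Z \<rightarrow> dual V N \<and> (\<forall>v\<in>V. continuous_map Z euclideanreal (\<lambda>z. q z v))"
  unfolding weak_star_topology_def continuous_map_in_subtopology continuous_map_componentwise
  using dual_extensional by blast

lemma continuous_map_weak_star_eval:
  "v \<in> V \<Longrightarrow> continuous_map (weak_star_topology V N) euclideanreal (\<lambda>\<phi>. \<phi> v)"
  using continuous_map_weak_star_iff[of "weak_star_topology V N" "\<lambda>\<phi>. \<phi>"] continuous_map_id
  by (auto simp: id_def)

lemma Hausdorff_weak_star: "Hausdorff_space (weak_star_topology V N)"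
  unfolding weak_star_topology_def
  by (intro Hausdorff_space_subtopology) (simp add: Hausdorff_space_product_topology)

text \<open>By Tychonoff the product of the intervals in \<open>?K\<close> is compact, and it
  contains the ball. The ball is closed because additivity, homogeneity and the bound are closed
  conditions, each on finitely many coordinates.\<close>

theorem Banach_Alaoglu:
  "compactin (weak_star_topology V N) {\<phi> \<in> dual V N. \<forall>v\<in>V. \<bar>\<phi> v\<bar> \<le> C * N v}"
    (is "compactin _ ?B")
proof -
  let ?P = "product_topology (\<lambda>_. euclideanreal) V"
  let ?K = "PiE V (\<lambda>v. {- (C * N v) .. C * N v})"
  have cont: "continuous_map ?P euclideanreal (\<lambda>\<phi>. \<phi> v)" if "v \<in> V" for v
    by (rule continuous_map_product_projection[OF that])
  have interval: "a \<in> {- c..c} \<longleftrightarrow> \<bar>a\<bar> \<le> c" for a c :: real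
    by auto
  have sub: "?B \<subseteq> ?K"
    by (auto simp: PiE_iff interval extensional_arb[OF dual_extensional] simp del: atLeastAtMost_iff
      intro: dual_extensional)
  have "closedin ?P ?B"
  proof -
    have "?P closure_of ?B \<subseteq> ?B"
    proof
      fix \<phi> assume \<phi>: "\<phi> \<in> ?P closure_of ?B"
      then have ext: "\<phi> \<in> extensional V"
        using closure_of_subset_topspace[of ?P ?B] by (auto simp: topspace_product_topology PiE_def)
      have "\<phi> (v + w) - (\<phi> v + \<phi> w) \<in> {0}" if "v \<in> V" "w \<in> V" for v w
        by (rule continuous_map_closure_of_in_closed[OF _ _ _ \<phi>])
          (use that in \<open>auto intro!: continuous_map_diff continuous_map_add cont V_add simp: dual_add\<close>)
      moreover have "\<phi> (c *\<^sub>R v) - c * \<phi> v \<in> {0}" if "v \<in> V" for c v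
        by (rule continuous_map_closure_of_in_closed[OF _ _ _ \<phi>])
          (use that in \<open>auto intro!: continuous_map_diff continuous_map_real_mult_left cont V_scale simp: dual_scale\<close>)
      moreover have bd: "\<forall>v\<in>V. \<bar>\<phi> v\<bar> \<le> C * N v"
      proof
        fix v assume v: "v \<in> V"
        have "\<phi> v \<in> {- (C * N v) .. C * N v}"
        by (rule continuous_map_closure_of_in_closed[OF _ _ _ \<phi>])
          (use v in \<open>auto intro!: cont simp only: interval mem_Collect_eq closed_atLeastAtMost\<close>)
        then show "\<bar>\<phi> v\<bar> \<le> C * N v" by (simp only: interval)
      qed
      ultimately have "\<phi> \<in> dual V N"
        using ext by (intro dualI[where C = C]) auto
      then show "\<phi> \<in> ?B" using bd by blast
    qed
    moreover have "?B \<subseteq> topspace ?P"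
      using dual_extensional by (auto simp: topspace_product_topology PiE_def)
    ultimately show ?thesis using closure_of_subset_eq by blast
  qed
  moreover have "compactin ?P ?K"
    by (simp add: compactin_PiE)
  ultimately have "compactin ?P ?B" using closed_compactin[OF _ sub] by blast
  then show ?thesis
    unfolding weak_star_topology_def by (auto simp: compactin_subtopology)
qed

lemma openin_norm_of_weak_star:
  assumes "openin (weak_star_topology V N) U"
  shows "openin (dual_norm_topology V N) U"
proof -
  have "continuous_map (dual_norm_topology V N) euclideanreal (\<lambda>\<phi>. \<phi> v)" if v: "v \<in> V" for v
    unfolding continuous_map_real_iff dual_norm_topology_def DM.topspace_mtopology
  proof (intro ballI allI impI)
    fix \<phi> and e :: real assume \<phi>: "\<phi> \<in> dual V N" and e: "e > 0"
    \<comment> \<open>The summand 1 keeps the denominator positive when \<open>N v = 0\<close> and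
      makes the final bound strict.\<close>
    define r where "r = e / (N v + 1)"
    have r: "r > 0" "r * N v < e"
      using e N_nonneg[OF v] by (auto simp: r_def field_simps)
    show "\<exists>U. openin DM.mtopology U \<and> \<phi> \<in> U \<and> (\<forall>\<theta>\<in>U. \<bar>\<theta> v - \<phi> v\<bar> < e)"
    proof (intro exI[of _ "DM.mball \<phi> r"] conjI ballI)
      fix \<theta> assume \<theta>: "\<theta> \<in> DM.mball \<phi> r"
      then have "\<bar>\<theta> v - \<phi> v\<bar> \<le> dual_dist V N \<phi> \<theta> * N v"
        using dual_dist_ge_mult[OF _ _ v, of \<phi> \<theta>] by (simp add: abs_minus_commute)
      also have "\<dots> \<le> r * N v"
        using \<theta> N_nonneg[OF v] by (intro mult_right_mono) auto
      finally show "\<bar>\<theta> v - \<phi> v\<bar> < e" using r(2) by linarith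
    qed (use \<phi> r in auto)
  qed
  then have "continuous_map (dual_norm_topology V N) (weak_star_topology V N) (\<lambda>\<phi>. \<phi>)"
    unfolding continuous_map_weak_star_iff by (simp add: dual_norm_topology_def)
  from openin_continuous_map_preimage[OF this assms] show ?thesis
    using openin_subset[OF assms] by (simp add: dual_norm_topology_def Int_absorb1 flip: Int_def)
qed

text \<open>The norm topology is always the finer one, so equality only asks that the trace of each
  norm ball contain the trace of a weak star neighbourhood of its centre. Both directions handle the
  coincidence of topologies in this pointwise form.\<close>

lemma weak_star_eq_norm_on_iff:
  assumes S: "S \<subseteq> dual V N"
  shows "subtopology (weak_star_topology V N) S = subtopology (dual_norm_topology V N) S \<longleftrightarrow>
    (\<forall>\<phi>\<in>S. \<forall>e>0. \<exists>U. openin (weak_star_topology V N) U \<and> \<phi> \<in> U \<and>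
       (\<forall>\<theta>\<in>U \<inter> S. dual_dist V N \<phi> \<theta> < e))"
    (is "?L \<longleftrightarrow> ?R")
proof
  assume eq: ?L
  show ?R
  proof (intro ballI allI impI)
    fix \<phi> and e :: real assume \<phi>: "\<phi> \<in> S" and e: "e > 0"
    have "openin (subtopology (dual_norm_topology V N) S) (DM.mball \<phi> e \<inter> S)"
      unfolding openin_subtopology dual_norm_topology_def by auto
    then obtain U where U: "openin (weak_star_topology V N) U" "DM.mball \<phi> e \<inter> S = U \<inter> S"
      unfolding eq[symmetric] openin_subtopology by blast
    have "\<phi> \<in> DM.mball \<phi> e" using \<phi> e S by auto
    moreover have "dual_dist V N \<phi> \<theta> < e" if "\<theta> \<in> U \<inter> S" for \<theta>
      using that U(2) by (metis DM.in_mball IntD1)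
    ultimately show "\<exists>U. openin (weak_star_topology V N) U \<and> \<phi> \<in> U \<and>
       (\<forall>\<theta>\<in>U \<inter> S. dual_dist V N \<phi> \<theta> < e)"
      using U \<phi> by blast
  qed
next
  assume R: ?R
  show ?L
    unfolding topology_eq
  proof (intro allI iffI)
    fix A assume "openin (subtopology (weak_star_topology V N) S) A"
    then show "openin (subtopology (dual_norm_topology V N) S) A"
      unfolding openin_subtopology using openin_norm_of_weak_star by blast
  next
    fix A assume "openin (subtopology (dual_norm_topology V N) S) A"
    then obtain W where W: "openin DM.mtopology W" "A = W \<inter> S"
      unfolding openin_subtopology dual_norm_topology_def by blast
    show "openin (subtopology (weak_star_topology V N) S) A"
    proof (subst openin_subopen, intro ballI)
      fix \<phi> assume \<phi>: "\<phi> \<in> A"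
      then obtain e where e: "e > 0" "DM.mball \<phi> e \<subseteq> W"
        using W unfolding DM.openin_mtopology by blast
      obtain U where U: "openin (weak_star_topology V N) U" "\<phi> \<in> U"
        "\<forall>\<theta>\<in>U \<inter> S. dual_dist V N \<phi> \<theta> < e"
        using R \<phi> W e(1) by blast
      have "U \<inter> S \<subseteq> A"
        using U(3) e(2) W(2) S \<phi> by (auto simp: subset_iff)
      then show "\<exists>T. openin (subtopology (weak_star_topology V N) S) T \<and> \<phi> \<in> T \<and> T \<subseteq> A"
        using U \<phi> W by (intro exI[of _ "U \<inter> S"]) (auto simp: openin_subtopology)
    qed
  qed
qed

end

section \<open>The weak-star orbit closure as a compact space\<close>

locale co_rep = banach V N for V :: "'v::real_vector set" and N :: "'v \<Rightarrow> real" +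
  fixes h :: "'g::topological_group_add \<Rightarrow> 'v \<Rightarrow> 'v"
  assumes co_rep: "continuous_co_representation V N h"
begin

interpretation VM: Metric_space V "norm_dist V N"
  by (rule Metric_space_norm_dist[OF banach])

interpretation DM: Metric_space "dual V N" "dual_dist V N"
  by (rule Metric_space_dual_dist[OF banach])

lemma h_Iso: "h g \<in> Iso V N"
  using co_rep by (simp add: continuous_co_representation_def)

lemma h_surj: "h g ` V = V"
  and N_h: "v \<in> V \<Longrightarrow> N (h g v) = N v"
  and h_add: "v \<in> V \<Longrightarrow> w \<in> V \<Longrightarrow> h g (v + w) = h g v + h g w"
  and h_scale: "v \<in> V \<Longrightarrow> h g (c *\<^sub>R v) = c *\<^sub>R h g v"
  using h_Iso[of g] by (simp_all add: Iso_def linear_on_subspace_def)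

lemma h_in: "v \<in> V \<Longrightarrow> h g v \<in> V"
  using h_surj by blast

lemma h_plus: "v \<in> V \<Longrightarrow> h (g1 + g2) v = h g2 (h g1 v)"
  using co_rep by (simp add: continuous_co_representation_def compose_def)

text \<open>A co-representation is only required to reverse products, so the unit law has to be
  derived: \<open>h 0\<close> is idempotent and maps \<open>V\<close> onto \<open>V\<close>, hence
  fixes every element.\<close>

lemma h_0: "v \<in> V \<Longrightarrow> h 0 v = v"
  using h_surj[of 0] h_plus[of _ 0 0] by (metis add_0 imageE)

lemma h_continuous:
  assumes v: "v \<in> V" and e: "e > 0"
  obtains U where "open U" "g0 \<in> U" "\<And>g. g \<in> U \<Longrightarrow> N (h g v - h g0 v) < e"
proof -
  have "continuous_map euclidean VM.mtopology (\<lambda>g. h g v)"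
    using co_rep v
    unfolding continuous_co_representation_def strong_operator_topology_def norm_topology_def
      continuous_map_in_subtopology continuous_map_componentwise
    by blast
  then obtain U where "open U" "g0 \<in> U" "\<forall>g\<in>U. h g v \<in> VM.mball (h g0 v) e"
    using e unfolding VM.continuous_map_to_metric by (metis UNIV_I open_openin topspace_euclidean)
  then show thesis
    using that[of U] h_in[OF v] VM.commute by (simp add: norm_dist_def) (metis (no_types, lifting))
qed

lemma dual_action_apply: "v \<in> V \<Longrightarrow> dual_action V h g \<phi> v = \<phi> (h g v)"
  by (simp add: dual_action_def)

lemma dual_action_bound:
  assumes "\<And>v. v \<in> V \<Longrightarrow> \<bar>\<phi> v\<bar> \<le> C * N v" "v \<in> V"
  shows "\<bar>dual_action V h g \<phi> v\<bar> \<le> C * N v"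
  using assms(1)[OF h_in] assms(2) by (simp add: dual_action_apply N_h)

lemma dual_action_dual: "\<phi> \<in> dual V N \<Longrightarrow> dual_action V h g \<phi> \<in> dual V N"
proof -
  assume \<phi>: "\<phi> \<in> dual V N"
  obtain C where "C \<ge> 0" "\<And>v. v \<in> V \<Longrightarrow> \<bar>\<phi> v\<bar> \<le> C * N v"
    using dual_bound[OF \<phi>] by metis
  from dual_action_bound[OF this(2)] show ?thesis
    using \<phi> V_add V_scale
    by (intro dualI[where C = C])
      (auto simp: dual_action_apply h_add h_scale dual_add dual_scale h_in,
       simp add: dual_action_def)
qed

lemma dual_action_0: "\<phi> \<in> dual V N \<Longrightarrow> dual_action V h 0 \<phi> = \<phi>"
  using dual_extensional[of \<phi>] by (auto simp: dual_action_def h_0 extensional_def)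

text \<open>\<open>h\<close> reverses products and so does passing to functionals; the two reversals
  cancel and leave a left action.\<close>

lemma dual_action_plus: "dual_action V h (g1 + g2) \<phi> = dual_action V h g1 (dual_action V h g2 \<phi>)"
  by (auto simp: dual_action_def h_plus h_in)

text \<open>\<open>h g\<close> maps the unit ball into itself. The equicontinuity in
  \<open>LE_G_space_YT\<close> rests on this bound being uniform in \<open>g\<close>.\<close>

lemma dual_dist_dual_action:
  assumes "\<phi> \<in> dual V N" "\<theta> \<in> dual V N"
  shows "dual_dist V N (dual_action V h g \<phi>) (dual_action V h g \<theta>) \<le> dual_dist V N \<phi> \<theta>"
  using assms
  by (intro dual_dist_leI dual_action_dual) (auto simp: dual_action_apply N_h h_in intro!: dual_dist_ge)

lemma dual_orbit_dual: "\<phi> \<in> dual V N \<Longrightarrow> dual_orbit V h \<phi> \<subseteq> dual V N"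
  unfolding dual_orbit_def using dual_action_dual by blast

lemma continuous_map_dual_action:
  "continuous_map (weak_star_topology V N) (weak_star_topology V N) (dual_action V h g)"
  unfolding continuous_map_weak_star_iff
  using dual_action_dual continuous_map_weak_star_eval[OF h_in] by (simp add: dual_action_apply)

context
  fixes \<psi> assumes \<psi>: "\<psi> \<in> dual V N"
begin

abbreviation (input) "Y \<equiv> weak_star_orbit_closure V N h \<psi>"
abbreviation (input) "YT \<equiv> subtopology (weak_star_topology V N) Y"

lemma Y_dual: "Y \<subseteq> dual V N"
  using closure_of_subset_topspace[of "weak_star_topology V N"]
  by (simp add: weak_star_orbit_closure_def)

lemma dual_Int_Y [simp]: "dual V N \<inter> Y = Y"
  using Y_dual by blast

lemma topspace_YT [simp]: "topspace YT = Y"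
  using Y_dual by auto

lemma orbit_subset_Y: "dual_orbit V h \<psi> \<subseteq> Y"
  unfolding weak_star_orbit_closure_def
  by (rule closure_of_subset) (simp add: dual_orbit_dual[OF \<psi>])

text \<open>Isometries preserve the bound of \<psi> along its orbit, and for fixed \<open>v\<close>
  the bound is a closed condition. The common constant gives compactness of \<open>Y\<close> and
  joint continuity of the action.\<close>

lemma Y_bound:
  obtains C where "C \<ge> 0" "\<And>\<phi> v. \<phi> \<in> Y \<Longrightarrow> v \<in> V \<Longrightarrow> \<bar>\<phi> v\<bar> \<le> C * N v"
proof -
  obtain C where C: "C \<ge> 0" "\<And>v. v \<in> V \<Longrightarrow> \<bar>\<psi> v\<bar> \<le> C * N v"
    using dual_bound[OF \<psi>] by metis
  have "\<phi> v \<in> cball 0 (C * N v)" if "\<phi> \<in> Y" "v \<in> V" for \<phi> v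
    using that(1) unfolding weak_star_orbit_closure_def
    by (rule continuous_map_closure_of_in_closed[OF continuous_map_weak_star_eval[OF that(2)], rotated 2])
      (use dual_action_bound[OF C(2) that(2)] in \<open>auto simp: dual_orbit_def\<close>)
  then show thesis using that[OF C(1)] by auto
qed

lemma compactin_Y: "compactin (weak_star_topology V N) Y"
proof -
  obtain C where "\<And>\<phi> v. \<phi> \<in> Y \<Longrightarrow> v \<in> V \<Longrightarrow> \<bar>\<phi> v\<bar> \<le> C * N v"
    using Y_bound by metis
  then show ?thesis
    using Y_dual by (intro closed_compactin[OF Banach_Alaoglu[of C]])
      (auto simp: weak_star_orbit_closure_def)
qed

lemma compact_YT: "compact_space YT"
  by (rule compact_space_subtopology[OF compactin_Y])

lemma Hausdorff_YT: "Hausdorff_space YT"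
  by (rule Hausdorff_space_subtopology[OF Hausdorff_weak_star])

lemma Y_invariant: "\<phi> \<in> Y \<Longrightarrow> dual_action V h g \<phi> \<in> Y"
proof -
  assume "\<phi> \<in> Y"
  then have "dual_action V h g \<phi> \<in> weak_star_topology V N closure_of (dual_action V h g ` dual_orbit V h \<psi>)"
    using continuous_map_image_closure_subset[OF continuous_map_dual_action]
    unfolding weak_star_orbit_closure_def by blast
  moreover have "dual_action V h g ` dual_orbit V h \<psi> \<subseteq> dual_orbit V h \<psi>"
    by (auto simp: dual_orbit_def simp flip: dual_action_plus)
  ultimately show ?thesis
    unfolding weak_star_orbit_closure_def using closure_of_mono by blast
qed

lemma continuous_map_YT_eval: "v \<in> V \<Longrightarrow> continuous_map YT euclideanreal (\<lambda>\<phi>. \<phi> v)"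
  by (intro continuous_map_from_subtopology continuous_map_weak_star_eval)

text \<open>Joint continuity is tested at each \<open>v\<close>. The difference
  \<open>\<phi> (h g v) - \<phi>0 (h g0 v)\<close> splits into
  \<open>\<phi> (h g v - h g0 v)\<close>, small uniformly over \<open>Y\<close> by
  \<open>Y_bound\<close> and strong continuity, and the change of one evaluation at
  \<open>h g0 v\<close>, small by weak star continuity.\<close>

lemma G_space_YT: "G_space YT (dual_action V h)"
  unfolding G_space_def
proof (intro conjI allI ballI)
  show "completely_regular_space YT"
    using compact_YT Hausdorff_YT compact_Hausdorff_or_regular_imp_normal_space
      normal_imp_completely_regular_space by blast
  show "Hausdorff_space YT" by (rule Hausdorff_YT)
  show "dual_action V h 0 \<phi> = \<phi>" if "\<phi> \<in> topspace YT" for \<phi>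
    using that Y_dual by (intro dual_action_0) auto
  show "dual_action V h (g1 + g2) \<phi> = dual_action V h g1 (dual_action V h g2 \<phi>)" for g1 g2 \<phi>
    by (rule dual_action_plus)
  obtain C where C: "C \<ge> 0" "\<And>\<phi> v. \<phi> \<in> Y \<Longrightarrow> v \<in> V \<Longrightarrow> \<bar>\<phi> v\<bar> \<le> C * N v"
    using Y_bound by metis
  have "continuous_map (prod_topology euclidean YT) euclideanreal (\<lambda>p. dual_action V h (fst p) (snd p) v)"
    if v: "v \<in> V" for v
    unfolding continuous_map_real_iff
  proof (intro ballI allI impI)
    fix p :: "'g \<times> ('v \<Rightarrow> real)" and e :: real
    assume p: "p \<in> topspace (prod_topology euclidean YT)" and e: "e > 0"
    obtain g0 \<phi>0 where p_eq: "p = (g0, \<phi>0)" by (cases p)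
    have \<phi>0: "\<phi>0 \<in> Y" using p p_eq by auto
    define d where "d = e / (2 * (C + 1))"
    have d: "d > 0" "C * d \<le> e / 2"
      using e C(1) by (auto simp: d_def field_simps)
    obtain U1 where U1: "open U1" "g0 \<in> U1" "\<And>g. g \<in> U1 \<Longrightarrow> N (h g v - h g0 v) < d"
      using h_continuous[OF v d(1)] by metis
    obtain U2 where U2: "openin YT U2" "\<phi>0 \<in> U2"
      "\<And>\<phi>. \<phi> \<in> U2 \<Longrightarrow> \<bar>\<phi> (h g0 v) - \<phi>0 (h g0 v)\<bar> < e / 2"
      using continuous_map_YT_eval[OF h_in[OF v, of g0]] \<phi>0 e
      unfolding continuous_map_real_iff topspace_YT by (meson half_gt_zero)
    show "\<exists>U. openin (prod_topology euclidean YT) U \<and> p \<in> U \<and>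
        (\<forall>q\<in>U. \<bar>dual_action V h (fst q) (snd q) v - dual_action V h (fst p) (snd p) v\<bar> < e)"
    proof (intro exI[of _ "U1 \<times> U2"] conjI ballI)
      show "openin (prod_topology euclidean YT) (U1 \<times> U2)"
        using U1(1) U2(1) by (simp add: openin_prod_Times_iff)
      show "p \<in> U1 \<times> U2" using U1 U2 p_eq by auto
      fix q assume "q \<in> U1 \<times> U2"
      then obtain g \<phi> where q: "q = (g, \<phi>)" "g \<in> U1" "\<phi> \<in> U2" by blast
      have \<phi>: "\<phi> \<in> Y" using openin_subset[OF U2(1)] q(3) by auto
      have "\<bar>\<phi> (h g v - h g0 v)\<bar> \<le> C * N (h g v - h g0 v)"
        using v by (intro C(2)[OF \<phi>] V_diff h_in)
      also have "\<dots> \<le> C * d"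
        using U1(3)[OF q(2)] C(1) by (intro mult_left_mono) auto
      finally have "\<bar>\<phi> (h g v) - \<phi> (h g0 v)\<bar> \<le> e / 2"
        using d(2) dual_diff[of \<phi>] \<phi> Y_dual h_in[OF v] by fastforce
      then show "\<bar>dual_action V h (fst q) (snd q) v - dual_action V h (fst p) (snd p) v\<bar> < e"
        using U2(3)[OF q(3)] unfolding q(1) p_eq dual_action_apply[OF v] fst_conv snd_conv
        by linarith
    qed
  qed
  then show "continuous_map (prod_topology euclidean YT) YT (\<lambda>(g, x). dual_action V h g x)"
    unfolding continuous_map_in_subtopology continuous_map_weak_star_iff case_prod_unfold
    using Y_invariant Y_dual by auto
qed

text \<open>The dual distance is a supremum of weak star continuous functions, hence lower
  semicontinuous. On the compact complement of an open neighbourhood of the diagonal it is positive,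
  so it is bounded away from 0 there.\<close>

lemma dual_dist_uniform:
  assumes \<epsilon>: "\<epsilon> \<in> compact_uniformity YT"
  obtains \<delta> where "\<delta> > 0" "\<And>\<phi> \<theta>. \<phi> \<in> Y \<Longrightarrow> \<theta> \<in> Y \<Longrightarrow> dual_dist V N \<phi> \<theta> \<le> \<delta> \<Longrightarrow> (\<phi>, \<theta>) \<in> \<epsilon>"
proof -
  let ?P = "prod_topology YT YT"
  obtain W where W: "openin ?P W" "Id_on Y \<subseteq> W" "W \<subseteq> \<epsilon>"
    using \<epsilon> unfolding compact_uniformity_eq[OF compact_YT Hausdorff_YT] by auto
  \<comment> \<open>The pairs at distance greater than \<open>r\<close>, expressed through a witness
    \<open>v\<close> so that openness is visible.\<close>
  define O' where "O' r = {p \<in> Y \<times> Y. \<exists>v\<in>V. N v \<le> 1 \<and> r < \<bar>fst p v - snd p v\<bar>}" for r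
  have openO: "openin ?P (O' r)" for r
  proof -
    have "openin ?P {p \<in> topspace ?P. \<bar>fst p v - snd p v\<bar> \<in> {r<..}}" if v: "v \<in> V" for v
    proof (rule openin_continuous_map_preimage)
      have "continuous_map ?P euclideanreal (\<lambda>p. fst p v)" "continuous_map ?P euclideanreal (\<lambda>p. snd p v)"
        using continuous_map_compose[OF continuous_map_fst continuous_map_YT_eval[OF v]]
          continuous_map_compose[OF continuous_map_snd continuous_map_YT_eval[OF v]]
        by (auto simp: o_def)
      then show "continuous_map ?P euclideanreal (\<lambda>p. \<bar>fst p v - snd p v\<bar>)"
        by (intro continuous_map_real_abs continuous_map_diff)
    qed auto
    then have "openin ?P (\<Union>v\<in>{v\<in>V. N v \<le> 1}. {p \<in> topspace ?P. \<bar>fst p v - snd p v\<bar> \<in> {r<..}})"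
      by blast
    moreover have "(\<Union>v\<in>{v\<in>V. N v \<le> 1}. {p \<in> topspace ?P. \<bar>fst p v - snd p v\<bar> \<in> {r<..}}) = O' r"
      unfolding O'_def topspace_prod_topology topspace_YT by auto
    ultimately show ?thesis by simp
  qed
  have K: "compactin ?P (Y \<times> Y - W)"
    using compact_YT W(1) closedin_compact_space[of ?P "Y \<times> Y - W"] closedin_diff[of ?P "Y \<times> Y" W]
      closedin_topspace[of ?P]
    by (simp add: compact_space_prod_topology)
  have cover: "Y \<times> Y - W \<subseteq> \<Union>(O' ` {0<..})"
  proof
    fix p assume p: "p \<in> Y \<times> Y - W"
    then obtain \<phi> \<theta> where eq: "p = (\<phi>, \<theta>)" "\<phi> \<in> Y" "\<theta> \<in> Y" "\<phi> \<noteq> \<theta>"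
      using W(2) by fastforce
    have D: "\<phi> \<in> dual V N" "\<theta> \<in> dual V N" using eq Y_dual by auto
    have pos: "dual_dist V N \<phi> \<theta> > 0"
      using D eq(4) DM.nonneg[of \<phi> \<theta>] DM.zero[of \<phi> \<theta>] by linarith
    have "p \<in> O' (dual_dist V N \<phi> \<theta> / 2)"
    proof (rule ccontr)
      assume "p \<notin> O' (dual_dist V N \<phi> \<theta> / 2)"
      then have "dual_dist V N \<phi> \<theta> \<le> dual_dist V N \<phi> \<theta> / 2"
        using eq D by (intro dual_dist_leI) (auto simp: O'_def not_less)
      then show False using pos by simp
    qed
    then show "p \<in> \<Union>(O' ` {0<..})" using pos by auto
  qed
  have "\<exists>\<F>. finite \<F> \<and> \<F> \<subseteq> O' ` {0<..} \<and> Y \<times> Y - W \<subseteq> \<Union>\<F>"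
    by (rule compactinD[OF K _ cover]) (use openO in auto)
  then obtain \<F> where F: "finite \<F>" "\<F> \<subseteq> O' ` {0<..}" "Y \<times> Y - W \<subseteq> \<Union>\<F>"
    by blast
  obtain R where R: "finite R" "R \<subseteq> {0<..}" "\<F> = O' ` R"
    using finite_subset_image[OF F(1,2)] by blast
  show thesis
  \<comment> \<open>The 1 covers the case of empty \<open>R\<close>, which may occur when
    \<open>W\<close> is all of \<open>Y \<times> Y\<close>.\<close>
  proof (rule that[of "Min (insert 1 R)"])
    show "Min (insert 1 R) > 0" using R by (subst Min_gr_iff) auto
    fix \<phi> \<theta> assume A: "\<phi> \<in> Y" "\<theta> \<in> Y" "dual_dist V N \<phi> \<theta> \<le> Min (insert 1 R)"
    show "(\<phi>, \<theta>) \<in> \<epsilon>"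
    proof (rule ccontr)
      assume "(\<phi>, \<theta>) \<notin> \<epsilon>"
      then have "(\<phi>, \<theta>) \<in> (\<Union>r\<in>R. O' r)"
        using A(1,2) F(3) R(3) W(3) by blast
      then obtain r v where r: "r \<in> R" "v \<in> V" "N v \<le> 1" "r < \<bar>\<phi> v - \<theta> v\<bar>"
        unfolding O'_def by auto
      have "\<phi> \<in> dual V N" "\<theta> \<in> dual V N" using A Y_dual by auto
      from dual_dist_ge[OF this r(2,3)] r(4) have "r < dual_dist V N \<phi> \<theta>"
        by linarith
      moreover have "Min (insert 1 R) \<le> r" using r R by simp
      ultimately show False using A by linarith
    qed
  qed
qed

lemma LE_G_space_YT:
  assumes eq: "\<And>\<phi>. \<phi> \<in> Y \<Longrightarrow> subtopology (weak_star_topology V N) (dual_orbit V h \<phi>) =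
        subtopology (dual_norm_topology V N) (dual_orbit V h \<phi>)"
  shows "LE_G_space YT (dual_action V h)"
  unfolding LE_G_space_def
proof (intro conjI ballI)
  fix \<phi> \<epsilon> assume "\<phi> \<in> topspace YT" and \<epsilon>: "\<epsilon> \<in> compact_uniformity YT"
  then have \<phi>: "\<phi> \<in> Y" by simp
  have \<phi>D: "\<phi> \<in> dual V N" using \<phi> Y_dual by blast
  obtain \<delta> where \<delta>: "\<delta> > 0"
    "\<And>\<phi> \<theta>. \<phi> \<in> Y \<Longrightarrow> \<theta> \<in> Y \<Longrightarrow> dual_dist V N \<phi> \<theta> \<le> \<delta> \<Longrightarrow> (\<phi>, \<theta>) \<in> \<epsilon>"
    using dual_dist_uniform[OF \<epsilon>] by metis
  have "\<phi> \<in> dual_orbit V h \<phi>"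
    using dual_action_0[OF \<phi>D] unfolding dual_orbit_def by (metis rangeI)
  then obtain U where U: "openin (weak_star_topology V N) U" "\<phi> \<in> U"
    "\<And>\<theta>. \<theta> \<in> U \<inter> dual_orbit V h \<phi> \<Longrightarrow> dual_dist V N \<phi> \<theta> < \<delta>"
    using eq[OF \<phi>] \<delta>(1) unfolding weak_star_eq_norm_on_iff[OF dual_orbit_dual[OF \<phi>D]] by meson
  \<comment> \<open>norm balls are weak-star closed, so the estimate passes from the orbit to its closure\<close>
  have close: "dual_dist V N \<phi> \<theta> \<le> \<delta>" if \<theta>: "\<theta> \<in> U \<inter> Y \<inter> orbit_closure YT (dual_action V h) \<phi>" for \<theta>
  proof (rule dual_dist_leI)
    show "\<phi> \<in> dual V N" "\<theta> \<in> dual V N" using \<phi> \<theta> Y_dual by auto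
    fix v assume v: "v \<in> V" "N v \<le> 1"
    show "\<bar>\<phi> v - \<theta> v\<bar> \<le> \<delta>"
    proof (rule ccontr)
      assume far: "\<not> ?thesis"
      \<comment> \<open>Were \<theta> farther than \<delta> from \<phi> in the direction
        \<open>v\<close>, then \<open>T\<close> would be a neighbourhood of \<theta> and so contain
        a point of the orbit; but orbit points in \<open>U\<close> are within \<delta>.\<close>
      define T where "T = {\<eta> \<in> topspace YT. \<bar>\<phi> v - \<eta> v\<bar> \<in> {\<delta><..}} \<inter> (U \<inter> Y)"
      have "openin YT (U \<inter> Y)"
        using U(1) by (auto simp: openin_subtopology)
      then have "openin YT T"
        unfolding T_def
        by (intro openin_Int[OF openin_continuous_map_preimage[where Y = euclideanreal]]
            continuous_map_real_abs continuous_map_diff continuous_map_YT_eval v) auto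
      moreover have "\<theta> \<in> T" using \<theta> far by (auto simp: T_def)
      ultimately obtain g where g: "dual_action V h g \<phi> \<in> T"
        using \<theta> unfolding orbit_closure_def Int_iff in_closure_of by blast
      then have "dual_dist V N \<phi> (dual_action V h g \<phi>) < \<delta>"
        using U(3) by (auto simp: T_def dual_orbit_def)
      moreover have "\<bar>\<phi> v - dual_action V h g \<phi> v\<bar> \<le> dual_dist V N \<phi> (dual_action V h g \<phi>)"
        by (rule dual_dist_ge[OF \<phi>D dual_action_dual[OF \<phi>D] v])
      ultimately show False using g by (auto simp: T_def)
    qed
  qed
  show "\<exists>U. openin YT U \<and> \<phi> \<in> U \<and>
     (\<forall>\<theta>\<in>U \<inter> orbit_closure YT (dual_action V h) \<phi>.
        \<forall>g. (dual_action V h g \<phi>, dual_action V h g \<theta>) \<in> \<epsilon>)"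
  proof (intro exI[of _ "U \<inter> Y"] conjI ballI allI)
    show "openin YT (U \<inter> Y)" using U(1) by (auto simp: openin_subtopology)
    show "\<phi> \<in> U \<inter> Y" using U(2) \<phi> by blast
    fix \<theta> g assume \<theta>: "\<theta> \<in> U \<inter> Y \<inter> orbit_closure YT (dual_action V h) \<phi>"
    have "dual_dist V N (dual_action V h g \<phi>) (dual_action V h g \<theta>) \<le> \<delta>"
      using dual_dist_dual_action[of \<phi> \<theta> g] close[OF \<theta>] \<theta> \<phi>D Y_dual by fastforce
    then show "(dual_action V h g \<phi>, dual_action V h g \<theta>) \<in> \<epsilon>"
      using \<theta> \<phi> by (intro \<delta>(2) Y_invariant) auto
  qed
qed (rule compact_YT G_space_YT)+

end

end

theorem LE_matrix_coefficient_imp_LE_factorization: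
  assumes "LE_matrix_coefficient f V N h v \<psi>"
  shows "LE_factorization f (subtopology (weak_star_topology V N) (weak_star_orbit_closure V N h \<psi>))
    (dual_action V h) (\<lambda>g. dual_action V h g \<psi>) (\<lambda>\<phi>. \<phi> v)"
proof -
  have *: "banach_space_on V N" "continuous_co_representation V N h" "v \<in> V" "\<psi> \<in> dual V N"
    "apply_bcontfun f = matrix_coefficient h v \<psi>"
    "\<And>\<phi>. \<phi> \<in> weak_star_orbit_closure V N h \<psi> \<Longrightarrow>
        subtopology (weak_star_topology V N) (dual_orbit V h \<phi>) =
        subtopology (dual_norm_topology V N) (dual_orbit V h \<phi>)"
    using assms unfolding LE_matrix_coefficient_def by blast+
  interpret co_rep V N h
    using * by unfold_locales
  let ?Y = "weak_star_orbit_closure V N h \<psi>"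
  let ?YT = "subtopology (weak_star_topology V N) ?Y"
  have G: "G_space ?YT (dual_action V h)" by (rule G_space_YT[OF *(4)])
  have \<psi>: "\<psi> \<in> ?Y"
    using orbit_subset_Y[OF *(4)] dual_action_0[OF *(4)] unfolding dual_orbit_def
    by (metis rangeI subsetD)
  show ?thesis
    unfolding LE_factorization_def
  proof (intro conjI allI)
    show "LE_G_space ?YT (dual_action V h)" by (rule LE_G_space_YT[OF *(4,6)])
    have "continuous_map euclidean (prod_topology euclidean ?YT) (\<lambda>g. (g, \<psi>))"
      using \<psi> topspace_YT[OF *(4)] by (simp add: continuous_map_pairwise o_def)
    from continuous_map_compose[OF this, of ?YT] G
    show "continuous_map euclidean ?YT (\<lambda>g. dual_action V h g \<psi>)"
      unfolding G_space_def by (fastforce simp: o_def)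
    show "dual_action V h (g1 + g2) \<psi> = dual_action V h g1 (dual_action V h g2 \<psi>)" for g1 g2
      by (rule dual_action_plus)
    have "?YT closure_of dual_orbit V h \<psi> = ?Y"
      using orbit_subset_Y[OF *(4)] unfolding closure_of_subtopology
      by (simp add: Int_absorb1) (simp add: weak_star_orbit_closure_def)
    then show "?YT closure_of range (\<lambda>g. dual_action V h g \<psi>) = topspace ?YT"
      unfolding topspace_YT[OF *(4)] dual_orbit_def .
    show "continuous_map ?YT euclideanreal (\<lambda>\<phi>. \<phi> v)"
      by (rule continuous_map_YT_eval[OF *(4,3)])
    show "apply_bcontfun f = (\<lambda>\<phi>. \<phi> v) \<circ> (\<lambda>g. dual_action V h g \<psi>)"
      using *(3,5) by (auto simp: matrix_coefficient_def dual_action_apply)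
  qed
qed

section \<open>The Hoelder space of a locally equicontinuous factorization\<close>

locale compact_G_space =
  fixes X :: "'x topology" and act :: "'g::topological_group_add \<Rightarrow> 'x \<Rightarrow> 'x"
  assumes compact: "compact_space X" and G_space: "G_space X act"
begin

lemma act_0: "x \<in> topspace X \<Longrightarrow> act 0 x = x"
  and act_plus: "x \<in> topspace X \<Longrightarrow> act (g + k) x = act g (act k x)"
  and act_continuous: "continuous_map (prod_topology euclidean X) X (\<lambda>p. act (fst p) (snd p))"
  and Hausdorff: "Hausdorff_space X"
  using G_space by (simp_all add: G_space_def case_prod_unfold)

lemma act_continuous_map: "continuous_map X X (act g)"
proof -
  have "continuous_map X (prod_topology euclidean X) (\<lambda>x. (g, x))"
    by (simp add: continuous_map_pairwise o_def)
  from continuous_map_compose[OF this act_continuous] show ?thesis by (simp add: o_def)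
qed

lemma act_in: "x \<in> topspace X \<Longrightarrow> act g x \<in> topspace X"
  using continuous_map_funspace[OF act_continuous_map] by blast

lemma act_minus: "x \<in> topspace X \<Longrightarrow> act (- g) (act g x) = x"
  using act_plus[of x "- g" g] act_0 by simp

lemma orbit_closure_subset: "orbit_closure X act x \<subseteq> topspace X"
  unfolding orbit_closure_def by (rule closure_of_subset_topspace)

lemma closedin_orbit_closure: "closedin X (orbit_closure X act x)"
  unfolding orbit_closure_def by (rule closedin_closure_of)

lemma act_in_orbit_closure: "x \<in> topspace X \<Longrightarrow> act g x \<in> orbit_closure X act x"
  unfolding orbit_closure_def using closure_of_subset[of "range (\<lambda>g. act g x)" X] act_in by auto

lemma self_in_orbit_closure: "x \<in> topspace X \<Longrightarrow> x \<in> orbit_closure X act x"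
  using act_in_orbit_closure[of x 0] act_0 by simp

lemma orbit_closure_invariant:
  assumes x: "x \<in> topspace X" and y: "y \<in> orbit_closure X act x"
  shows "act g y \<in> orbit_closure X act x"
proof -
  have "act g y \<in> X closure_of (act g ` range (\<lambda>k. act k x))"
    using continuous_map_image_closure_subset[OF act_continuous_map] y
    unfolding orbit_closure_def by blast
  moreover have "act g ` range (\<lambda>k. act k x) \<subseteq> range (\<lambda>k. act k x)"
    using act_plus[OF x] by (auto simp flip: act_plus[OF x])
  ultimately show ?thesis
    unfolding orbit_closure_def using closure_of_mono by blast
qed

text \<open>Zorn's lemma is applied to the open invariant sets that do not cover \<open>Z\<close>; the complement
  of a maximal one is a minimal closed invariant set meeting \<open>Z\<close>.\<close>

lemma ex_minimal_orbit_closure: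
  assumes Z: "closedin X Z" "Z \<noteq> {}"
  shows "\<exists>x\<in>Z. \<forall>y\<in>Z \<inter> orbit_closure X act x. orbit_closure X act y = orbit_closure X act x"
proof -
  define \<A> where "\<A> = {U. openin X U \<and> (\<forall>g. \<forall>u\<in>U. act g u \<in> U) \<and> \<not> Z \<subseteq> U}"
  have ZX: "Z \<subseteq> topspace X" using closedin_subset[OF Z(1)] .
  have "\<exists>M\<in>\<A>. \<forall>U\<in>\<A>. M \<subseteq> U \<longrightarrow> U = M"
  proof (rule subset_Zorn_nonempty)
    show "\<A> \<noteq> {}" using Z(2) by (auto simp: \<A>_def intro!: exI[of _ "{}"])
    fix \<C> assume C: "\<C> \<noteq> {}" "subset.chain \<A> \<C>"
    then have CA: "\<C> \<subseteq> \<A>" by (simp add: subset_chain_def)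
    \<comment> \<open>If the union covered the compact set \<open>Z\<close>, finitely many members
      would; the largest of them in the chain would cover \<open>Z\<close> alone.\<close>
    have "\<not> Z \<subseteq> \<Union>\<C>"
    proof
      assume cover: "Z \<subseteq> \<Union>\<C>"
      have "compactin X Z" using compact Z(1) by (simp add: closedin_compact_space)
      then have "\<exists>\<F>. finite \<F> \<and> \<F> \<subseteq> \<C> \<and> Z \<subseteq> \<Union>\<F>"
        by (rule compactinD[OF _ _ cover]) (use CA in \<open>auto simp: \<A>_def\<close>)
      then obtain \<F> where F: "finite \<F>" "\<F> \<subseteq> \<C>" "Z \<subseteq> \<Union>\<F>" by blast
      have "\<F> \<noteq> {}" using F(3) Z(2) by auto
      moreover have "subset.chain \<A> \<F>"
        using C(2) F(2) unfolding subset_chain_def by (meson subsetD subset_trans)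
      ultimately have "\<Union>\<F> \<in> \<F>" using Union_in_chain[OF F(1)] by blast
      then show False using F CA by (auto simp: \<A>_def)
    qed
    then show "\<Union>\<C> \<in> \<A>" using CA by (auto simp: \<A>_def)
  qed
  then obtain M where M: "M \<in> \<A>" "\<And>U. U \<in> \<A> \<Longrightarrow> M \<subseteq> U \<Longrightarrow> U = M" by blast
  \<comment> \<open>The complement of the orbit closure of \<open>y\<close> is open, invariant and
    misses \<open>y\<close>. It contains \<open>M\<close>: otherwise the open set \<open>M\<close>
    would meet the orbit of \<open>y\<close> and, by invariance, contain \<open>y\<close>.
    Maximality gives equality, so all points of \<open>Z - M\<close> have the same orbit
    closure.\<close>
  have cl: "orbit_closure X act y = topspace X - M" if y: "y \<in> Z - M" for y
  proof -
    have yX: "y \<in> topspace X" using y ZX by blast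
    let ?U = "topspace X - orbit_closure X act y"
    have "act g u \<in> ?U" if "u \<in> ?U" for g u
      using that act_in orbit_closure_invariant[OF yX, of "act g u" "- g"] act_minus by auto
    then have "?U \<in> \<A>"
      using y self_in_orbit_closure[OF yX] closedin_orbit_closure by (auto simp: \<A>_def)
    moreover have "M \<subseteq> ?U"
    proof
      fix m assume m: "m \<in> M"
      have "openin X M" using M(1) by (simp add: \<A>_def)
      have "m \<notin> orbit_closure X act y"
      proof
        assume "m \<in> orbit_closure X act y"
        then obtain g where "act g y \<in> M"
          using m \<open>openin X M\<close> unfolding orbit_closure_def in_closure_of by blast
        then have "act (- g) (act g y) \<in> M" using M(1) by (simp add: \<A>_def)
        then show False using y act_minus[OF yX] by simp
      qed
      then show "m \<in> ?U" using m openin_subset[OF \<open>openin X M\<close>] by blast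
    qed
    ultimately have "?U = M" using M(2) by blast
    then show ?thesis using orbit_closure_subset by blast
  qed
  obtain x where x: "x \<in> Z - M" using M(1) by (auto simp: \<A>_def)
  show ?thesis
    by (rule bexI[of _ x]) (use x cl in auto)
qed

end

locale LE_factor =
  fixes f :: "'g::topological_group_add \<Rightarrow>\<^sub>C real" and X :: "'x topology"
    and act :: "'g \<Rightarrow> 'x \<Rightarrow> 'x" and \<nu> :: "'g \<Rightarrow> 'x" and F :: "'x \<Rightarrow> real"
  assumes factorization: "LE_factorization f X act \<nu> F"

sublocale LE_factor \<subseteq> compact_G_space X act
  using factorization by unfold_locales (auto simp: LE_factorization_def LE_G_space_def)

context LE_factor
begin

lemma \<nu>_continuous: "continuous_map euclidean X \<nu>"
  and \<nu>_plus: "\<nu> (g + k) = act g (\<nu> k)"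
  and \<nu>_dense: "X closure_of (range \<nu>) = topspace X"
  and F_continuous: "continuous_map X euclideanreal F"
  and f_eq: "apply_bcontfun f g = F (\<nu> g)"
  using factorization by (simp_all add: LE_factorization_def)

lemma \<nu>_in: "\<nu> g \<in> topspace X"
  using continuous_map_funspace[OF \<nu>_continuous] by auto

lemma continuous_map_bounded:
  assumes "continuous_map X euclideanreal \<Phi>"
  obtains B where "B \<ge> 0" "\<And>x. x \<in> topspace X \<Longrightarrow> \<bar>\<Phi> x\<bar> \<le> B"
proof -
  have "compactin euclideanreal (\<Phi> ` topspace X)"
    using image_compactin[OF _ assms] compact by (simp add: compact_space_def)
  then have "bounded (\<Phi> ` topspace X)" by (simp add: compact_imp_bounded)
  then show thesis using that unfolding bounded_pos by (auto intro: less_imp_le)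
qed

section \<open>Continuous functions on X regarded as functions on the group\<close>

definition pull :: "('x \<Rightarrow> real) \<Rightarrow> 'g \<Rightarrow>\<^sub>C real" where
  "pull \<Phi> = Bcontfun (\<Phi> \<circ> \<nu>)"

lemma pull_apply:
  assumes "continuous_map X euclideanreal \<Phi>"
  shows "apply_bcontfun (pull \<Phi>) g = \<Phi> (\<nu> g)"
proof -
  obtain B where B: "\<And>x. x \<in> topspace X \<Longrightarrow> \<bar>\<Phi> x\<bar> \<le> B"
    using continuous_map_bounded[OF assms] by metis
  have "continuous_on UNIV (\<Phi> \<circ> \<nu>)"
    using continuous_map_compose[OF \<nu>_continuous assms] by simp
  then have "\<Phi> \<circ> \<nu> \<in> bcontfun"
    by (rule bcontfun_normI) (use B \<nu>_in in auto)
  then show ?thesis unfolding pull_def by (simp add: Bcontfun_inverse)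
qed

text \<open>A copy of the continuous functions on X inside C(G). Working with the copy keeps
  \<open>V\<close> on the prescribed type whatever type carries X.\<close>

definition CX :: "('g \<Rightarrow>\<^sub>C real) set" where
  "CX = pull ` {\<Phi>. continuous_map X euclideanreal \<Phi>}"

text \<open>The inverse of \<open>pull\<close>. The choice is unique on \<open>topspace X\<close>
  because \<nu> has dense image, and arbitrary outside it.\<close>

definition ext :: "('g \<Rightarrow>\<^sub>C real) \<Rightarrow> 'x \<Rightarrow> real" where
  "ext v = (SOME \<Phi>. continuous_map X euclideanreal \<Phi> \<and> pull \<Phi> = v)"

lemma ext_continuous: "v \<in> CX \<Longrightarrow> continuous_map X euclideanreal (ext v)"
  and pull_ext: "v \<in> CX \<Longrightarrow> pull (ext v) = v"
  unfolding CX_def ext_def by (smt (verit, ccfv_SIG) image_iff mem_Collect_eq someI_ex)+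

lemma ext_\<nu>: "v \<in> CX \<Longrightarrow> ext v (\<nu> g) = apply_bcontfun v g"
  using pull_apply[OF ext_continuous] pull_ext by metis

lemma pull_in: "continuous_map X euclideanreal \<Phi> \<Longrightarrow> pull \<Phi> \<in> CX"
  unfolding CX_def by blast

text \<open>Continuous functions that agree on the dense image of \<nu> agree on X. Extensions of
  sums, multiples and translates are computed this way.\<close>

lemma CX_ext_eqI:
  assumes \<Phi>: "continuous_map X euclideanreal \<Phi>" and v: "\<And>g. apply_bcontfun v g = \<Phi> (\<nu> g)"
  shows "v \<in> CX" and ext_eq: "x \<in> topspace X \<Longrightarrow> ext v x = \<Phi> x"
proof -
  have "v = pull \<Phi>" using v pull_apply[OF \<Phi>] by (intro bcontfun_eqI) simp
  then show CX: "v \<in> CX" using pull_in[OF \<Phi>] by simp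
  assume "x \<in> topspace X"
  then have "x \<in> X closure_of (range \<nu>)" by (simp add: \<nu>_dense)
  then have "ext v x - \<Phi> x \<in> {0}"
    by (rule continuous_map_closure_of_in_closed[rotated 3])
      (use v ext_\<nu>[OF CX] in \<open>auto intro!: continuous_map_diff ext_continuous CX \<Phi>\<close>)
  then show "ext v x = \<Phi> x" by simp
qed

lemma ext_pull:
  "continuous_map X euclideanreal \<Phi> \<Longrightarrow> x \<in> topspace X \<Longrightarrow> ext (pull \<Phi>) x = \<Phi> x"
  by (rule ext_eq[OF _ pull_apply])

lemma CX_eqI:
  assumes "v \<in> CX" "w \<in> CX" "\<And>x. x \<in> topspace X \<Longrightarrow> ext v x = ext w x"
  shows "v = w"
  using assms \<nu>_in by (intro bcontfun_eqI) (metis ext_\<nu>)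

lemma
  assumes v: "v \<in> CX" and w: "w \<in> CX"
  shows CX_add: "v + w \<in> CX" and ext_add: "x \<in> topspace X \<Longrightarrow> ext (v + w) x = ext v x + ext w x"
    and CX_diff: "v - w \<in> CX" and ext_diff: "x \<in> topspace X \<Longrightarrow> ext (v - w) x = ext v x - ext w x"
proof -
  note c = ext_continuous[OF v] ext_continuous[OF w]
  show "v + w \<in> CX" "x \<in> topspace X \<Longrightarrow> ext (v + w) x = ext v x + ext w x"
    using CX_ext_eqI[OF continuous_map_add[OF c], of "v + w"] ext_\<nu> v w by auto
  show "v - w \<in> CX" "x \<in> topspace X \<Longrightarrow> ext (v - w) x = ext v x - ext w x"
    using CX_ext_eqI[OF continuous_map_diff[OF c], of "v - w"] ext_\<nu> v w by auto
qed

lemma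
  assumes v: "v \<in> CX"
  shows CX_scale: "c *\<^sub>R v \<in> CX" and ext_scale: "x \<in> topspace X \<Longrightarrow> ext (c *\<^sub>R v) x = c * ext v x"
  using CX_ext_eqI[OF continuous_map_real_mult_left[OF ext_continuous[OF v], of c], of "c *\<^sub>R v"]
    ext_\<nu> v by auto

lemma CX_0: "0 \<in> CX" and ext_0: "x \<in> topspace X \<Longrightarrow> ext 0 x = 0"
  using CX_ext_eqI[of "\<lambda>_. 0" 0] by auto

text \<open>The translate \<open>k \<mapsto> v (g + k)\<close>, as \<open>tr_apply\<close> shows;
  defining it through X makes membership in \<open>CX\<close> immediate.\<close>

definition tr :: "'g \<Rightarrow> ('g \<Rightarrow>\<^sub>C real) \<Rightarrow> 'g \<Rightarrow>\<^sub>C real" where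
  "tr g v = pull (ext v \<circ> act g)"

lemma
  assumes v: "v \<in> CX"
  shows CX_tr: "tr g v \<in> CX" and ext_tr: "x \<in> topspace X \<Longrightarrow> ext (tr g v) x = ext v (act g x)"
    and tr_apply: "apply_bcontfun (tr g v) k = apply_bcontfun v (g + k)"
proof -
  have c: "continuous_map X euclideanreal (ext v \<circ> act g)"
    by (rule continuous_map_compose[OF act_continuous_map ext_continuous[OF v]])
  show "tr g v \<in> CX" unfolding tr_def by (rule pull_in[OF c])
  show "x \<in> topspace X \<Longrightarrow> ext (tr g v) x = ext v (act g x)"
    unfolding tr_def using ext_pull[OF c] by simp
  show "apply_bcontfun (tr g v) k = apply_bcontfun v (g + k)"
    unfolding tr_def pull_apply[OF c] using ext_\<nu>[OF v] by (simp flip: \<nu>_plus)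
qed

text \<open>Translations compose in reverse order (\<open>tr_tr\<close>), which is why they form a
  co-representation.\<close>

lemma tr_add: "v \<in> CX \<Longrightarrow> w \<in> CX \<Longrightarrow> tr g (v + w) = tr g v + tr g w"
  and tr_scale: "v \<in> CX \<Longrightarrow> tr g (c *\<^sub>R v) = c *\<^sub>R tr g v"
  and tr_tr: "v \<in> CX \<Longrightarrow> tr g (tr k v) = tr (k + g) v"
  and tr_0: "v \<in> CX \<Longrightarrow> tr 0 v = v"
  by (auto intro!: bcontfun_eqI simp: tr_apply CX_tr CX_add CX_scale add.assoc)

section \<open>The pseudometric \<rho> and the Hoelder space built on it\<close>

definition \<rho> :: "'x \<Rightarrow> 'x \<Rightarrow> real" where
  "\<rho> x y = (SUP g. \<bar>F (act g x) - F (act g y)\<bar>)"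

lemma \<rho>_upper:
  assumes "x \<in> topspace X" "y \<in> topspace X"
  shows "\<bar>F (act g x) - F (act g y)\<bar> \<le> \<rho> x y"
proof -
  obtain B where B: "\<And>x. x \<in> topspace X \<Longrightarrow> \<bar>F x\<bar> \<le> B"
    using continuous_map_bounded[OF F_continuous] by metis
  have "\<bar>F (act g x) - F (act g y)\<bar> \<le> 2 * B" for g
    using B[OF act_in[OF assms(1), of g]] B[OF act_in[OF assms(2), of g]] by linarith
  then show ?thesis
    unfolding \<rho>_def by (intro cSUP_upper bdd_aboveI2[where M = "2 * B"]) auto
qed

lemma \<rho>_least: "(\<And>g. \<bar>F (act g x) - F (act g y)\<bar> \<le> r) \<Longrightarrow> \<rho> x y \<le> r"
  unfolding \<rho>_def by (rule cSUP_least) auto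

lemma \<rho>_nonneg: "x \<in> topspace X \<Longrightarrow> y \<in> topspace X \<Longrightarrow> 0 \<le> \<rho> x y"
  using \<rho>_upper[of x y 0] by linarith

lemma \<rho>_act: "x \<in> topspace X \<Longrightarrow> y \<in> topspace X \<Longrightarrow> \<rho> (act g x) (act g y) \<le> \<rho> x y"
  by (rule \<rho>_least) (use \<rho>_upper in \<open>simp flip: act_plus\<close>)

text \<open>Local equicontinuity enters the construction here, for the entourage on which
  \<open>F\<close> varies by less than \<open>e\<close>; it controls all translates at once, hence
  their supremum.\<close>

lemma \<rho>_equicontinuous:
  assumes x0: "x0 \<in> topspace X" and e: "e > 0"
  obtains U where "openin X U" "x0 \<in> U" "\<And>x. x \<in> U \<Longrightarrow> x \<in> orbit_closure X act x0 \<Longrightarrow> \<rho> x0 x \<le> e"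
proof -
  let ?P = "prod_topology X X"
  define E where "E = {p \<in> topspace ?P. \<bar>F (fst p) - F (snd p)\<bar> \<in> {..<e}}"
  have "continuous_map ?P euclideanreal (\<lambda>p. F (fst p))" "continuous_map ?P euclideanreal (\<lambda>p. F (snd p))"
    using continuous_map_compose[OF continuous_map_fst F_continuous]
      continuous_map_compose[OF continuous_map_snd F_continuous]
    by (auto simp: o_def)
  then have "openin ?P E"
    unfolding E_def
    by (intro openin_continuous_map_preimage[where Y = euclideanreal] continuous_map_real_abs
        continuous_map_diff) auto
  moreover have "Id_on (topspace X) \<subseteq> E" using e by (auto simp: E_def)
  moreover have "E \<subseteq> topspace X \<times> topspace X" by (auto simp: E_def)
  ultimately have "E \<in> compact_uniformity X"
    unfolding compact_uniformity_eq[OF compact Hausdorff] by blast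
  then obtain U where U: "openin X U" "x0 \<in> U"
    "\<forall>x \<in> U \<inter> orbit_closure X act x0. \<forall>g. (act g x0, act g x) \<in> E"
    using factorization x0 unfolding LE_factorization_def LE_G_space_def by meson
  show thesis
    by (rule that[OF U(1,2)]) (use U(3) in \<open>force simp: E_def intro!: \<rho>_least intro: less_imp_le\<close>)
qed

text \<open>The Hoelder exponent 1/2 is what makes translates of \<open>f\<close> converge: differences of
  translates are small and \<open>2\<rho>\<close>-Lipschitz, hence small in the Hoelder norm.\<close>

definition hoelder :: "('g \<Rightarrow>\<^sub>C real) \<Rightarrow> real \<Rightarrow> bool" where
  "hoelder v t \<longleftrightarrow> (\<forall>x\<in>topspace X. \<bar>ext v x\<bar> \<le> t) \<and>
     (\<forall>x\<in>topspace X. \<forall>y\<in>topspace X. \<bar>ext v x - ext v y\<bar> \<le> t * sqrt (\<rho> x y))"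

lemma hoelder_nonneg: "hoelder v t \<Longrightarrow> 0 \<le> t"
  using \<nu>_in[of 0] abs_ge_zero[of "ext v (\<nu> 0)"] unfolding hoelder_def by (meson order_trans)

lemma hoelder_mono: "hoelder v s \<Longrightarrow> s \<le> t \<Longrightarrow> hoelder v t"
  unfolding hoelder_def using \<rho>_nonneg
  by (meson mult_right_mono order_trans real_sqrt_ge_zero)

lemma hoelder_0: "0 \<le> t \<Longrightarrow> hoelder 0 t"
  unfolding hoelder_def using \<rho>_nonneg by (auto simp: ext_0)

lemma hoelder_add:
  assumes "v \<in> CX" "w \<in> CX" "hoelder v s" "hoelder w t"
  shows "hoelder (v + w) (s + t)"
  unfolding hoelder_def
proof (intro conjI ballI)
  fix x y assume x: "x \<in> topspace X" and y: "y \<in> topspace X"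
  show "\<bar>ext (v + w) x\<bar> \<le> s + t"
    using assms x unfolding hoelder_def by (simp add: ext_add) (meson abs_triangle_ineq add_mono order_trans)
  have "\<bar>ext v x - ext v y\<bar> \<le> s * sqrt (\<rho> x y)" "\<bar>ext w x - ext w y\<bar> \<le> t * sqrt (\<rho> x y)"
    using assms x y unfolding hoelder_def by blast+
  then show "\<bar>ext (v + w) x - ext (v + w) y\<bar> \<le> (s + t) * sqrt (\<rho> x y)"
    using assms x y by (simp add: ext_add distrib_right)
qed

lemma hoelder_scale:
  assumes "v \<in> CX" "hoelder v t"
  shows "hoelder (c *\<^sub>R v) (\<bar>c\<bar> * t)"
  using assms unfolding hoelder_def
  by (auto simp: ext_scale abs_mult mult_left_mono mult.assoc simp flip: right_diff_distrib)

lemma hoelder_tr: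
  assumes "v \<in> CX" "hoelder v t"
  shows "hoelder (tr g v) t"
  unfolding hoelder_def
proof (intro conjI ballI)
  fix x y assume x: "x \<in> topspace X" and y: "y \<in> topspace X"
  show "\<bar>ext (tr g v) x\<bar> \<le> t"
    using assms x act_in unfolding hoelder_def by (simp add: ext_tr)
  have "\<bar>ext v (act g x) - ext v (act g y)\<bar> \<le> t * sqrt (\<rho> (act g x) (act g y))"
    using assms x y act_in unfolding hoelder_def by blast
  also have "\<dots> \<le> t * sqrt (\<rho> x y)"
    using \<rho>_act[OF x y] hoelder_nonneg[OF assms(2)] by (intro mult_left_mono) auto
  finally show "\<bar>ext (tr g v) x - ext (tr g v) y\<bar> \<le> t * sqrt (\<rho> x y)"
    using assms x y by (simp add: ext_tr)
qed

text \<open>Continuity of translates is stated through \<open>hoelder\<close> because the infimum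
  \<open>N\<close> says nothing about a function without any Hoelder bound.\<close>

definition V :: "('g \<Rightarrow>\<^sub>C real) set" where
  "V = {v \<in> CX. (\<exists>t. hoelder v t) \<and>
     (\<forall>g0. \<forall>e>0. \<exists>U. open U \<and> g0 \<in> U \<and> (\<forall>g\<in>U. hoelder (tr g v - tr g0 v) e))}"

text \<open>On \<open>V\<close> this is the maximum of the sup norm and the Hoelder constant, since
  one \<open>t\<close> serves both inequalities in \<open>hoelder\<close>.\<close>

definition N :: "('g \<Rightarrow>\<^sub>C real) \<Rightarrow> real" where
  "N v = Inf {t. hoelder v t}"

lemma V_CX: "v \<in> V \<Longrightarrow> v \<in> CX" and V_hoelder: "v \<in> V \<Longrightarrow> \<exists>t. hoelder v t"
  by (simp_all add: V_def)

lemma N_le: "hoelder v t \<Longrightarrow> N v \<le> t"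
  unfolding N_def by (rule cInf_lower) (auto intro!: bdd_belowI[of _ 0] hoelder_nonneg)

text \<open>The infimum is attained because all conditions are non-strict and linear in
  \<open>t\<close>. Pairs with \<open>\<rho> x y = 0\<close> do not constrain \<open>t\<close> and
  are treated apart from the division.\<close>

lemma hoelder_N:
  assumes "hoelder v s"
  shows "hoelder v (N v)"
proof -
  have ne: "{t. hoelder v t} \<noteq> {}" using assms by blast
  have "\<bar>ext v x - ext v y\<bar> \<le> N v * sqrt (\<rho> x y)"
    if xy: "x \<in> topspace X" "y \<in> topspace X" for x y
  proof (cases "\<rho> x y = 0")
    case True
    then show ?thesis using assms xy unfolding hoelder_def by fastforce
  next
    case False
    then have pos: "sqrt (\<rho> x y) > 0" using \<rho>_nonneg[OF xy] by simp
    have "\<bar>ext v x - ext v y\<bar> / sqrt (\<rho> x y) \<le> N v"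
      unfolding N_def using xy pos
      by (intro cInf_greatest[OF ne]) (auto simp: hoelder_def pos_divide_le_eq)
    then show ?thesis using pos by (simp add: pos_divide_le_eq)
  qed
  moreover have "\<bar>ext v x\<bar> \<le> N v" if "x \<in> topspace X" for x
    unfolding N_def using that by (intro cInf_greatest[OF ne]) (auto simp: hoelder_def)
  ultimately show ?thesis by (simp add: hoelder_def)
qed

lemma V_hoelder_N: "v \<in> V \<Longrightarrow> hoelder v (N v)"
  using hoelder_N V_hoelder by blast

lemma ext_le_N: "v \<in> V \<Longrightarrow> x \<in> topspace X \<Longrightarrow> \<bar>ext v x\<bar> \<le> N v"
  using V_hoelder_N unfolding hoelder_def by blast

lemma subspace_V: "subspace V"
proof (rule subspaceI)
  have tr0: "tr g 0 = 0" for g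
    using tr_scale[OF CX_0, of g 0] by simp
  show "0 \<in> V"
    unfolding V_def using hoelder_0 CX_0 tr0 by (auto intro: less_imp_le)
next
  fix v w assume v: "v \<in> V" and w: "w \<in> V"
  note C = V_CX[OF v] V_CX[OF w]
  have "\<exists>U. open U \<and> g0 \<in> U \<and> (\<forall>g\<in>U. hoelder (tr g (v + w) - tr g0 (v + w)) e)"
    if e: "e > 0" for g0 and e :: real
  proof -
    obtain U1 U2 where U: "open U1" "g0 \<in> U1" "\<forall>g\<in>U1. hoelder (tr g v - tr g0 v) (e / 2)"
      "open U2" "g0 \<in> U2" "\<forall>g\<in>U2. hoelder (tr g w - tr g0 w) (e / 2)"
      using v w half_gt_zero[OF e] unfolding V_def by blast
    have "hoelder (tr g (v + w) - tr g0 (v + w)) e" if "g \<in> U1 \<inter> U2" for g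
    proof -
      have "hoelder ((tr g v - tr g0 v) + (tr g w - tr g0 w)) (e / 2 + e / 2)"
        using U that by (intro hoelder_add CX_diff CX_tr C) auto
      then show ?thesis by (simp add: tr_add C algebra_simps)
    qed
    then show ?thesis using U by (intro exI[of _ "U1 \<inter> U2"]) auto
  qed
  then show "v + w \<in> V"
    using V_hoelder[OF v] V_hoelder[OF w] hoelder_add[OF C] CX_add[OF C] unfolding V_def by blast
next
  fix c v assume v: "v \<in> V"
  note C = V_CX[OF v]
  have "\<exists>U. open U \<and> g0 \<in> U \<and> (\<forall>g\<in>U. hoelder (tr g (c *\<^sub>R v) - tr g0 (c *\<^sub>R v)) e)"
    if e: "e > 0" for g0 and e :: real
  proof -
    define d where "d = e / (\<bar>c\<bar> + 1)"
    have d: "d > 0" "\<bar>c\<bar> * d \<le> e" using e by (auto simp: d_def field_simps add_nonneg_pos)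
    obtain U where U: "open U" "g0 \<in> U" "\<forall>g\<in>U. hoelder (tr g v - tr g0 v) d"
      using v d unfolding V_def by blast
    have "hoelder (tr g (c *\<^sub>R v) - tr g0 (c *\<^sub>R v)) e" if "g \<in> U" for g
      using hoelder_mono[OF hoelder_scale[OF CX_diff[OF CX_tr[OF C] CX_tr[OF C]], of g g0 d c] d(2)]
        U that by (simp add: tr_scale C algebra_simps)
    then show ?thesis using U by blast
  qed
  then show "c *\<^sub>R v \<in> V"
    using V_hoelder[OF v] hoelder_scale[OF C] CX_scale[OF C] unfolding V_def by blast
qed

text \<open>Continuity at \<open>g0\<close> for the translates of \<open>tr k v\<close> is
  continuity at \<open>k + g0\<close> for those of \<open>v\<close>, pulled back along a left
  translation of the group.\<close>

lemma tr_V: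
  assumes v: "v \<in> V"
  shows "tr k v \<in> V"
proof -
  note C = V_CX[OF v]
  have "\<exists>U. open U \<and> g0 \<in> U \<and> (\<forall>g\<in>U. hoelder (tr g (tr k v) - tr g0 (tr k v)) e)"
    if e: "e > 0" for g0 and e :: real
  proof -
    obtain U where U: "open U" "k + g0 \<in> U" "\<forall>g\<in>U. hoelder (tr g v - tr (k + g0) v) e"
      using v e unfolding V_def by blast
    have "continuous_on UNIV (\<lambda>g. k + g)" by (intro continuous_intros)
    then have "open ((\<lambda>g. k + g) -` U)" using U(1) by (rule open_vimage[rotated])
    then show ?thesis
      using U by (intro exI[of _ "(\<lambda>g. k + g) -` U"]) (auto simp: tr_tr C)
  qed
  then show ?thesis
    using V_hoelder[OF v] hoelder_tr[OF C] CX_tr[OF C] unfolding V_def by blast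
qed

lemma N_tr: "v \<in> V \<Longrightarrow> N (tr g v) = N v"
proof (rule antisym)
  show le: "N (tr g v) \<le> N v" if "v \<in> V" for g v
    using that by (intro N_le hoelder_tr V_CX V_hoelder_N)
  show "v \<in> V \<Longrightarrow> N v \<le> N (tr g v)"
    using le[OF tr_V[of v g], of "- g"] by (simp add: tr_tr tr_0 V_CX)
qed

lemma f_V: "f \<in> V"
proof -
  have fC: "f \<in> CX" and ext_f: "\<And>x. x \<in> topspace X \<Longrightarrow> ext f x = F x"
    using CX_ext_eqI[OF F_continuous f_eq] by auto
  obtain B where B: "B \<ge> 0" "\<And>x. x \<in> topspace X \<Longrightarrow> \<bar>F x\<bar> \<le> B"
    using continuous_map_bounded[OF F_continuous] by metis
  \<comment> \<open>Used with a sup bound and a Lipschitz bound on one difference: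
    \<open>2 * B\<close> and \<open>\<rho> x y\<close> for \<open>f\<close>, then
    \<open>2 * d\<close> and \<open>2 * \<rho> x y\<close> for a difference of two
    translates.\<close>
  have interpolate: "\<bar>a\<bar> \<le> sqrt (s * t)" if "\<bar>a\<bar> \<le> s" "\<bar>a\<bar> \<le> t" for a s t :: real
  proof (rule real_le_rsqrt)
    show "\<bar>a\<bar>\<^sup>2 \<le> s * t"
      using that mult_mono[of "\<bar>a\<bar>" s "\<bar>a\<bar>" t] by (simp add: power2_eq_square)
  qed
  have "hoelder f (B + sqrt (2 * B))"
    unfolding hoelder_def
  proof (intro conjI ballI)
    fix x y assume x: "x \<in> topspace X" and y: "y \<in> topspace X"
    show "\<bar>ext f x\<bar> \<le> B + sqrt (2 * B)" using B x by (simp add: ext_f add_increasing2)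
    have "\<bar>F x - F y\<bar> \<le> sqrt (2 * B * \<rho> x y)"
      using B(2)[OF x] B(2)[OF y] \<rho>_upper[OF x y, of 0] x y by (intro interpolate) (auto simp: act_0)
    also have "\<dots> \<le> (B + sqrt (2 * B)) * sqrt (\<rho> x y)"
      using B \<rho>_nonneg[OF x y] by (simp add: real_sqrt_mult distrib_right)
    finally show "\<bar>ext f x - ext f y\<bar> \<le> (B + sqrt (2 * B)) * sqrt (\<rho> x y)"
      using x y by (simp add: ext_f)
  qed
  moreover have "\<exists>U. open U \<and> g0 \<in> U \<and> (\<forall>g\<in>U. hoelder (tr g f - tr g0 f) e)"
    if e: "e > 0" for g0 and e :: real
  proof -
    \<comment> \<open>\<open>d \<le> e\<close> serves the sup bound;
      \<open>4 * d \<le> e\<^sup>2\<close> turns the interpolated bound into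
      \<open>e * sqrt (\<rho> x y)\<close>.\<close>
    define d where "d = min e (e\<^sup>2 / 4)"
    have d: "d > 0" "d \<le> e" "sqrt (2 * d * 2) \<le> e"
    proof -
      show "d > 0" "d \<le> e" using e by (auto simp: d_def)
      have "2 * d * 2 \<le> e\<^sup>2" by (simp add: d_def min_def)
      then show "sqrt (2 * d * 2) \<le> e" using e by (intro real_le_lsqrt) auto
    qed
    let ?P = "prod_topology euclidean X :: ('g \<times> 'x) topology"
    let ?W = "{p \<in> topspace ?P. F (act (fst p) (snd p)) - F (act g0 (snd p)) \<in> {-d<..<d}}"
    have "continuous_map ?P euclideanreal (\<lambda>p. F (act (fst p) (snd p)))"
      using continuous_map_compose[OF act_continuous F_continuous] by (simp add: o_def)
    moreover have "continuous_map ?P euclideanreal (\<lambda>p. F (act g0 (snd p)))"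
      using continuous_map_compose[OF continuous_map_snd
          continuous_map_compose[OF act_continuous_map F_continuous]] by (simp add: o_def)
    ultimately have W: "openin ?P ?W"
      by (intro openin_continuous_map_preimage[where Y = euclideanreal] continuous_map_diff) auto
    have sub: "{g0} \<times> topspace X \<subseteq> ?W" using d by auto
    \<comment> \<open>The tube lemma over the compact space X: one neighbourhood of
      \<open>g0\<close> serves all points of X.\<close>
    have "compactin euclidean {g0}" "compactin X (topspace X)"
      using compact by (auto simp: compact_space_def)
    then obtain U U' where U: "openin euclidean U" "{g0} \<subseteq> U" "topspace X \<subseteq> U'" "U \<times> U' \<subseteq> ?W"
      by (rule Wallace_theorem_prod_topology[OF _ _ W sub])
    have close: "\<bar>F (act g x) - F (act g0 x)\<bar> \<le> d" if "g \<in> U" "x \<in> topspace X" for g x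
    proof -
      have "(g, x) \<in> ?W" using U(3,4) that by blast
      then show ?thesis by auto
    qed
    have "hoelder (tr g f - tr g0 f) e" if g: "g \<in> U" for g
      unfolding hoelder_def
    proof (intro conjI ballI)
      fix x y assume x: "x \<in> topspace X" and y: "y \<in> topspace X"
      let ?D = "\<lambda>x. ext (tr g f - tr g0 f) x"
      have D: "?D x = F (act g x) - F (act g0 x)" if "x \<in> topspace X" for x
        using that by (simp add: ext_diff ext_tr CX_tr fC ext_f act_in)
      show "\<bar>?D x\<bar> \<le> e" using close[OF g x] d(2) D[OF x] by simp
      have "\<bar>?D x - ?D y\<bar> \<le> sqrt ((2 * d) * (2 * \<rho> x y))"
        using close[OF g x] close[OF g y] \<rho>_upper[OF x y, of g] \<rho>_upper[OF x y, of g0]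
        unfolding D[OF x] D[OF y] by (intro interpolate) linarith+
      also have "\<dots> = sqrt (2 * d * 2) * sqrt (\<rho> x y)"
        by (simp flip: real_sqrt_mult)
      also have "\<dots> \<le> e * sqrt (\<rho> x y)"
        using d(3) \<rho>_nonneg[OF x y] by (intro mult_right_mono) auto
      finally show "\<bar>?D x - ?D y\<bar> \<le> e * sqrt (\<rho> x y)" .
    qed
    then show ?thesis using U by auto
  qed
  ultimately show ?thesis using fC unfolding V_def by blast
qed

text \<open>Each Hoelder inequality involves at most two points and so survives pointwise limits. In
  the proof of completeness this lets the second index of the Cauchy condition tend to
  infinity.\<close>

lemma hoelder_diff_of_limit:
  assumes "v \<in> CX" "w \<in> CX" and M: "\<And>m. m \<ge> M \<Longrightarrow> \<sigma> m \<in> CX \<and> hoelder (v - \<sigma> m) e"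
    and lim: "\<And>x. x \<in> topspace X \<Longrightarrow> (\<lambda>m. ext (\<sigma> m) x) \<longlonglongrightarrow> ext w x"
  shows "hoelder (v - w) e"
  unfolding hoelder_def
proof (intro conjI ballI)
  fix x y assume x: "x \<in> topspace X" and y: "y \<in> topspace X"
  have ev: "eventually (\<lambda>m. \<bar>ext v x - ext (\<sigma> m) x\<bar> \<le> e \<and>
      \<bar>(ext v x - ext (\<sigma> m) x) - (ext v y - ext (\<sigma> m) y)\<bar> \<le> e * sqrt (\<rho> x y)) sequentially"
  proof (rule eventually_sequentiallyI)
    fix m assume "M \<le> m"
    then show "\<bar>ext v x - ext (\<sigma> m) x\<bar> \<le> e \<and>
      \<bar>(ext v x - ext (\<sigma> m) x) - (ext v y - ext (\<sigma> m) y)\<bar> \<le> e * sqrt (\<rho> x y)"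
      using M[of m] x y assms(1) unfolding hoelder_def by (metis ext_diff)
  qed
  show "\<bar>ext (v - w) x\<bar> \<le> e"
    unfolding ext_diff[OF assms(1,2) x]
    by (rule tendsto_upperbound[OF tendsto_rabs[OF tendsto_diff[OF tendsto_const lim[OF x]]]
          eventually_mono[OF ev]]) auto
  show "\<bar>ext (v - w) x - ext (v - w) y\<bar> \<le> e * sqrt (\<rho> x y)"
    unfolding ext_diff[OF assms(1,2) x] ext_diff[OF assms(1,2) y]
    by (rule tendsto_upperbound[OF tendsto_rabs[OF tendsto_diff[OF
          tendsto_diff[OF tendsto_const lim[OF x]] tendsto_diff[OF tendsto_const lim[OF y]]]]
          eventually_mono[OF ev]]) auto
qed

lemma N_triangle:
  assumes "v \<in> V" "w \<in> V"
  shows "N (v + w) \<le> N v + N w"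
  using assms by (intro N_le hoelder_add V_CX V_hoelder_N)

lemma N_scaleR:
  assumes v: "v \<in> V"
  shows "N (c *\<^sub>R v) = \<bar>c\<bar> * N v"
proof -
  have le: "N (c *\<^sub>R v) \<le> \<bar>c\<bar> * N v" if "v \<in> V" for c v
    using that by (intro N_le hoelder_scale V_CX V_hoelder_N)
  have "\<bar>c\<bar> * N v \<le> N (c *\<^sub>R v)"
  proof (cases "c = 0")
    case True
    then show ?thesis
      using hoelder_nonneg[OF V_hoelder_N[OF subspace_scale[OF subspace_V v, of c]]] by simp
  next
    case False
    have "N v = N (inverse c *\<^sub>R c *\<^sub>R v)" using False by simp
    also have "\<dots> \<le> \<bar>inverse c\<bar> * N (c *\<^sub>R v)"
      by (rule le[OF subspace_scale[OF subspace_V v]])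
    finally show ?thesis using False by (simp add: field_simps abs_inverse)
  qed
  with le[OF v, of c] show ?thesis by simp
qed

lemma V_limit:
  assumes \<sigma>: "\<And>n::nat. \<sigma> n \<in> V"
    and cauchy: "\<And>e. e > 0 \<Longrightarrow> \<exists>M. \<forall>n\<ge>M. \<forall>m\<ge>M. N (\<sigma> n - \<sigma> m) < e"
  obtains w where "w \<in> V" "\<And>e. e > 0 \<Longrightarrow> \<exists>M. \<forall>n\<ge>M. N (\<sigma> n - w) \<le> e"
proof -
  note C = V_CX[OF \<sigma>]
  have diff: "\<sigma> n - \<sigma> m \<in> V" for n m
    by (rule subspace_diff[OF subspace_V \<sigma> \<sigma>])
  have hC: "\<exists>M. \<forall>n\<ge>M. \<forall>m\<ge>M. hoelder (\<sigma> n - \<sigma> m) e" if "e > 0" for e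
    using cauchy[OF that] hoelder_mono[OF V_hoelder_N[OF diff]] by (meson less_imp_le)
  then have uC: "\<exists>M. \<forall>n\<ge>M. \<forall>m\<ge>M. \<forall>x\<in>topspace X. \<bar>ext (\<sigma> n) x - ext (\<sigma> m) x\<bar> \<le> e" if "e > 0" for e
    using that unfolding hoelder_def by (simp add: ext_diff C) meson
  define \<Phi> where "\<Phi> x = lim (\<lambda>n. ext (\<sigma> n) x)" for x
  have lim: "(\<lambda>n. ext (\<sigma> n) x) \<longlonglongrightarrow> \<Phi> x" if x: "x \<in> topspace X" for x
  proof -
    have "Cauchy (\<lambda>n. ext (\<sigma> n) x)"
      unfolding Cauchy_def dist_real_def
    proof (intro allI impI)
      fix e :: real assume "e > 0"
      then obtain M where "\<forall>n\<ge>M. \<forall>m\<ge>M. \<forall>x\<in>topspace X. \<bar>ext (\<sigma> n) x - ext (\<sigma> m) x\<bar> \<le> e / 2"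
        using uC[of "e / 2"] by auto
      then show "\<exists>M. \<forall>m\<ge>M. \<forall>n\<ge>M. \<bar>ext (\<sigma> m) x - ext (\<sigma> n) x\<bar> < e"
        using x \<open>e > 0\<close> by (intro exI[of _ M]) fastforce
    qed
    then show ?thesis unfolding \<Phi>_def using real_Cauchy_convergent convergent_LIMSEQ_iff by blast
  qed
  \<comment> \<open>The norm dominates the sup norm, so the convergence is uniform on X.\<close>
  have "continuous_map X Met_TC.mtopology \<Phi>"
  proof (rule Met_TC.continuous_map_uniform_limit)
    show "\<forall>\<^sub>F n in sequentially. continuous_map X Met_TC.mtopology (ext (\<sigma> n))"
      using ext_continuous[OF C] by simp
    fix e :: real assume e: "e > 0"
    then obtain M where M: "\<forall>n\<ge>M. \<forall>m\<ge>M. \<forall>x\<in>topspace X. \<bar>ext (\<sigma> n) x - ext (\<sigma> m) x\<bar> \<le> e / 2"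
      using uC[of "e / 2"] by auto
    have "\<bar>ext (\<sigma> n) x - \<Phi> x\<bar> \<le> e / 2" if "n \<ge> M" "x \<in> topspace X" for n x
      by (rule tendsto_upperbound[OF tendsto_rabs[OF tendsto_diff[OF tendsto_const lim[OF that(2)]]]])
        (use M that in \<open>auto simp: eventually_sequentially\<close>)
    then show "\<forall>\<^sub>F n in sequentially. \<forall>x\<in>topspace X. \<Phi> x \<in> UNIV \<and> dist (ext (\<sigma> n) x) (\<Phi> x) < e"
      using e unfolding eventually_sequentially dist_real_def by (intro exI[of _ M]) fastforce
  qed simp
  then have \<Phi>: "continuous_map X euclideanreal \<Phi>" by simp
  define w where "w = pull \<Phi>"
  have w: "w \<in> CX" and ext_w: "\<And>x. x \<in> topspace X \<Longrightarrow> ext w x = \<Phi> x"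
    using pull_in[OF \<Phi>] ext_pull[OF \<Phi>] by (auto simp: w_def)
  have conv: "\<exists>M. \<forall>n\<ge>M. hoelder (\<sigma> n - w) e" if e: "e > 0" for e
  proof -
    obtain M where M: "\<forall>n\<ge>M. \<forall>m\<ge>M. hoelder (\<sigma> n - \<sigma> m) e" using hC[OF e] by blast
    have "hoelder (\<sigma> n - w) e" if "n \<ge> M" for n
      using M that C lim ext_w
      by (intro hoelder_diff_of_limit[OF C w, where M = M and \<sigma> = \<sigma>]) auto
    then show ?thesis by blast
  qed
  have "w \<in> V"
  proof -
    obtain n where "hoelder (\<sigma> n - w) 1" using conv[of 1] by auto
    from hoelder_add[OF C CX_scale[OF CX_diff[OF C w]] V_hoelder_N[OF \<sigma>]
        hoelder_scale[OF CX_diff[OF C w] this], of n "-1"]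
    have "\<exists>t. hoelder w t" by auto
    moreover have "\<exists>U. open U \<and> g0 \<in> U \<and> (\<forall>g\<in>U. hoelder (tr g w - tr g0 w) e)"
      if e: "e > 0" for g0 and e :: real
    proof -
      obtain n where n: "hoelder (\<sigma> n - w) (e / 3)"
        using conv[of "e / 3"] e by auto
      obtain U where U: "open U" "g0 \<in> U" "\<forall>g\<in>U. hoelder (tr g (\<sigma> n) - tr g0 (\<sigma> n)) (e / 3)"
        using \<sigma>[of n] e unfolding V_def by (auto dest!: spec[of _ g0] spec[of _ "e / 3"])
      note D = CX_diff[OF C w]
      have neg: "hoelder ((-1) *\<^sub>R tr g (\<sigma> n - w)) (\<bar>-1\<bar> * (e / 3))" for g
        by (rule hoelder_scale[OF CX_tr[OF D] hoelder_tr[OF D n]])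
      have "hoelder (tr g w - tr g0 w) e" if "g \<in> U" for g
      proof -
        have tr_diff: "tr g (\<sigma> n - w) = tr g (\<sigma> n) - tr g w" for g
          using tr_add[OF C CX_scale[OF w], of g n "-1"] tr_scale[OF w, of g "-1"] by simp
        \<comment> \<open>An e/3 argument for \<open>tr g w - tr g0 w\<close>; the outer two terms
          are small for all \<open>g\<close> because translation preserves Hoelder bounds.\<close>
        have "hoelder ((-1) *\<^sub>R tr g (\<sigma> n - w) + (tr g (\<sigma> n) - tr g0 (\<sigma> n)) + tr g0 (\<sigma> n - w))
            (\<bar>-1\<bar> * (e / 3) + e / 3 + e / 3)"
          using U(3) that
          by (intro hoelder_add[OF _ _ hoelder_add] hoelder_tr D n neg CX_add CX_scale CX_tr CX_diff C w)
            auto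
        then show ?thesis by (simp add: tr_diff)
      qed
      then show ?thesis using U by blast
    qed
    ultimately show ?thesis using w unfolding V_def by blast
  qed
  then show thesis using that conv N_le by meson
qed

lemma banach_space_V: "banach_space_on V N"
proof -
  have pos: "0 \<le> N v" and N_eq_0: "N v = 0 \<longleftrightarrow> v = 0" if v: "v \<in> V" for v
  proof -
    show "0 \<le> N v" by (rule hoelder_nonneg[OF V_hoelder_N[OF v]])
    show "N v = 0 \<longleftrightarrow> v = 0"
    proof
      assume "N v = 0"
      then show "v = 0"
        using ext_le_N[OF v] by (intro CX_eqI V_CX v CX_0) (simp add: ext_0)
    next
      assume "v = 0"
      then show "N v = 0" using N_scaleR[OF v, of 0] by simp
    qed
  qed
  \<comment> \<open>\<open>Metric_space_norm_dist\<close> presupposes a Banach space, so the metric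
    axioms are proved directly before completeness can be addressed.\<close>
  have metric: "Metric_space V (norm_dist V N)"
  proof
    fix v w u
    show "0 \<le> norm_dist V N v w"
      using pos subspace_diff[OF subspace_V] by (simp add: norm_dist_def)
    show "norm_dist V N v w = norm_dist V N w v"
      using N_scaleR[OF subspace_diff[OF subspace_V, of v w], of "-1"] by (simp add: norm_dist_def)
    show "norm_dist V N v w = 0 \<longleftrightarrow> v = w" if "v \<in> V" "w \<in> V"
      using that N_eq_0 subspace_diff[OF subspace_V] by (simp add: norm_dist_def)
    show "norm_dist V N v u \<le> norm_dist V N v w + norm_dist V N w u"
      if "v \<in> V" "w \<in> V" "u \<in> V"
      using N_triangle[OF subspace_diff[OF subspace_V] subspace_diff[OF subspace_V], of v w w u] that
      by (simp add: norm_dist_def)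
  qed
  interpret Metric_space V "norm_dist V N" by (rule metric)
  have "mcomplete"
    unfolding mcomplete_def
  proof (intro allI impI)
    fix \<sigma> assume M: "MCauchy \<sigma>"
    then have \<sigma>: "\<sigma> n \<in> V" for n by (auto simp: MCauchy_def)
    have "\<exists>M. \<forall>n\<ge>M. \<forall>m\<ge>M. N (\<sigma> n - \<sigma> m) < e" if "e > 0" for e
      using M that \<sigma> unfolding MCauchy_def norm_dist_def by auto
    from V_limit[OF \<sigma> this] obtain w where w: "w \<in> V" "\<And>e. e > 0 \<Longrightarrow> \<exists>M. \<forall>n\<ge>M. N (\<sigma> n - w) \<le> e"
      by metis
    have "\<exists>M. \<forall>n\<ge>M. \<sigma> n \<in> V \<and> norm_dist V N (\<sigma> n) w < e" if "e > 0" for e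
      using w(2)[of "e / 2"] that \<sigma> w(1) unfolding norm_dist_def by fastforce
    then show "\<exists>w. limitin mtopology \<sigma> w sequentially"
      unfolding limit_metric_sequentially using w(1) by blast
  qed
  then show ?thesis
    unfolding banach_space_on_def by (auto simp: subspace_V pos N_eq_0 N_scaleR N_triangle)
qed

sublocale B: banach V N
  by unfold_locales (rule banach_space_V)

section \<open>Translation operators and evaluation functionals on \<open>V\<close>\<close>

definition h :: "'g \<Rightarrow> ('g \<Rightarrow>\<^sub>C real) \<Rightarrow> 'g \<Rightarrow>\<^sub>C real" where
  "h g = (\<lambda>v\<in>V. tr g v)"

lemma h_Iso: "h g \<in> Iso V N"
proof -
  have "h g ` V = V"
  proof
    show "h g ` V \<subseteq> V" by (auto simp: h_def tr_V)
    show "V \<subseteq> h g ` V"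
    proof
      fix v assume v: "v \<in> V"
      have "v = h g (tr (- g) v)" using v by (simp add: h_def tr_V tr_tr tr_0 V_CX)
      then show "v \<in> h g ` V" using tr_V[OF v] by blast
    qed
  qed
  then show ?thesis
    unfolding Iso_def linear_on_subspace_def
    by (auto simp: h_def tr_add tr_scale V_CX N_tr B.V_add B.V_scale)
qed

lemma co_representation_h: "continuous_co_representation V N h"
  unfolding continuous_co_representation_def
proof (intro conjI allI)
  interpret VM: Metric_space V "norm_dist V N"
    by (rule Metric_space_norm_dist[OF banach_space_V])
  show "h g \<in> Iso V N" for g by (rule h_Iso)
  show "h (g1 + g2) = compose V (h g2) (h g1)" for g1 g2
    by (auto simp: h_def compose_def tr_tr V_CX tr_V)
  have "continuous_map euclidean VM.mtopology (\<lambda>g. h g v)" if v: "v \<in> V" for v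
    unfolding VM.continuous_map_to_metric
  proof (intro ballI allI impI)
    fix g0 :: 'g and e :: real assume e: "e > 0"
    obtain U where U: "open U" "g0 \<in> U" "\<forall>g\<in>U. hoelder (tr g v - tr g0 v) (e / 2)"
      using v half_gt_zero[OF e] unfolding V_def by blast
    have "h g v \<in> VM.mball (h g0 v) e" if "g \<in> U" for g
    proof -
      have "N (tr g v - tr g0 v) \<le> e / 2" using N_le U(3) that by blast
      then have "norm_dist V N (tr g v) (tr g0 v) < e"
        using e v by (simp add: norm_dist_def tr_V)
      then show ?thesis using v VM.commute by (simp add: h_def tr_V)
    qed
    then show "\<exists>U. openin euclidean U \<and> g0 \<in> U \<and> (\<forall>g\<in>U. h g v \<in> VM.mball (h g0 v) e)"
      using U by auto
  qed
  then show "continuous_map euclidean (strong_operator_topology V N) h"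
    using h_Iso unfolding strong_operator_topology_def continuous_map_in_subtopology
      continuous_map_componentwise norm_topology_def
    by (auto simp: Iso_def)
qed

text \<open>An equivariant map from X to the dual. It identifies x and y exactly when
  \<open>\<rho> x y = 0\<close>: one way by \<open>dual_dist_q_le\<close>, the other because the
  translates of \<open>f\<close> lie in \<open>V\<close>.\<close>

definition q :: "'x \<Rightarrow> ('g \<Rightarrow>\<^sub>C real) \<Rightarrow> real" where
  "q x = (\<lambda>v\<in>V. ext v x)"

lemma q_dual: "x \<in> topspace X \<Longrightarrow> q x \<in> dual V N"
  by (rule B.dualI[where C = 1])
    (auto simp: q_def ext_add ext_scale V_CX B.V_add B.V_scale ext_le_N)

lemma q_continuous: "continuous_map X (weak_star_topology V N) q"
  unfolding B.continuous_map_weak_star_iff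
  using q_dual ext_continuous[OF V_CX] by (auto simp: q_def)

lemma dual_action_q: "x \<in> topspace X \<Longrightarrow> dual_action V h g (q x) = q (act g x)"
  by (auto simp: dual_action_def q_def h_def tr_V ext_tr V_CX)

lemma q_\<nu>: "v \<in> V \<Longrightarrow> q (\<nu> g) v = apply_bcontfun v g"
  by (simp add: q_def ext_\<nu> V_CX)

lemma dual_orbit_q: "x \<in> topspace X \<Longrightarrow> dual_orbit V h (q x) = range (\<lambda>g. q (act g x))"
  by (simp add: dual_orbit_def dual_action_q)

lemma dual_dist_q_le:
  assumes "x \<in> topspace X" "y \<in> topspace X"
  shows "dual_dist V N (q x) (q y) \<le> sqrt (\<rho> x y)"
proof (rule B.dual_dist_leI)
  fix v assume v: "v \<in> V" "N v \<le> 1"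
  then have "\<bar>ext v x - ext v y\<bar> \<le> 1 * sqrt (\<rho> x y)"
    using hoelder_mono[OF V_hoelder_N[OF v(1)] v(2)] assms unfolding hoelder_def by blast
  then show "\<bar>q x v - q y v\<bar> \<le> sqrt (\<rho> x y)" using v by (simp add: q_def)
qed (use assms q_dual in auto)

text \<open>The image of X is compact, hence weak star closed, and contains the orbit. So the
  coincidence of topologies need only be checked on orbits of evaluations.\<close>

lemma orbit_closure_dual_orbit:
  "weak_star_orbit_closure V N h (q (\<nu> 0)) \<subseteq> q ` topspace X"
proof -
  have "compactin (weak_star_topology V N) (q ` topspace X)"
    using image_compactin[OF _ q_continuous] compact by (simp add: compact_space_def)
  then have "closedin (weak_star_topology V N) (q ` topspace X)"
    by (rule compactin_imp_closedin[OF B.Hausdorff_weak_star])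
  then show ?thesis
    unfolding weak_star_orbit_closure_def dual_orbit_q[OF \<nu>_in]
    by (intro closure_of_minimal) (auto simp: \<nu>_in act_in)
qed

text \<open>Equicontinuity at \<open>x0\<close> along its orbit closure need not pass to the other points of the
  fibre of \<open>q\<close>; it does when the orbit closure is minimal among those meeting that fibre.\<close>

lemma norm_neighbourhood_on_orbit:
  assumes x0: "x0 \<in> topspace X" and e: "e > 0"
  obtains U where "openin (weak_star_topology V N) U" "q x0 \<in> U"
    "\<And>\<theta>. \<theta> \<in> U \<Longrightarrow> \<theta> \<in> dual_orbit V h (q x0) \<Longrightarrow> dual_dist V N (q x0) \<theta> < e"
proof -
  let ?W = "weak_star_topology V N"
  define Z where "Z = {x \<in> topspace X. q x \<in> {q x0}}"
  have "closedin ?W {q x0}"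
    using B.Hausdorff_weak_star q_dual[OF x0] by (simp add: closedin_Hausdorff_sing_eq)
  then have "closedin X Z"
    unfolding Z_def by (rule closedin_continuous_map_preimage[OF q_continuous])
  moreover have "Z \<noteq> {}" using x0 by (auto simp: Z_def)
  ultimately obtain x where x: "x \<in> Z"
    "\<And>y. y \<in> Z \<inter> orbit_closure X act x \<Longrightarrow> orbit_closure X act y = orbit_closure X act x"
    using ex_minimal_orbit_closure by meson
  have xX: "x \<in> topspace X" and qx: "q x = q x0" using x(1) by (auto simp: Z_def)
  let ?C = "orbit_closure X act x"
  \<comment> \<open>By minimality the orbit closure of \<open>y\<close> is all of \<open>?C\<close>,
    so equicontinuity at \<open>y\<close> holds along \<open>?C\<close>. The square anticipates the
    root in \<open>dual_dist_q_le\<close>, and the half makes the final inequality strict.\<close>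
  have "\<exists>U. openin X U \<and> y \<in> U \<and> (\<forall>z\<in>U \<inter> ?C. \<rho> y z \<le> (e / 2)\<^sup>2)" if "y \<in> Z \<inter> ?C" for y
  proof -
    have "y \<in> topspace X" "(e / 2)\<^sup>2 > 0" using that e by (auto simp: Z_def)
    then show ?thesis
      using \<rho>_equicontinuous[of y "(e / 2)\<^sup>2"] x(2)[OF that] by (metis IntD1 IntD2)
  qed
  then obtain U where U: "\<And>y. y \<in> Z \<inter> ?C \<Longrightarrow>
      openin X (U y) \<and> y \<in> U y \<and> (\<forall>z\<in>U y \<inter> ?C. \<rho> y z \<le> (e / 2)\<^sup>2)"
    by metis
  \<comment> \<open>The fibre points in \<open>?C\<close> are all covered by the sets
    \<open>U y\<close>, so the closed set \<open>q\<close> of \<open>K\<close> misses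
    \<open>q x0\<close>; its complement is the required neighbourhood.\<close>
  define K where "K = ?C - (\<Union>y\<in>Z \<inter> ?C. U y)"
  have "closedin X K"
    unfolding K_def using U by (intro closedin_diff closedin_orbit_closure) blast
  then have "compactin ?W (q ` K)"
    using compact by (intro image_compactin[OF _ q_continuous] closedin_compact_space)
  then have "closedin ?W (q ` K)"
    by (rule compactin_imp_closedin[OF B.Hausdorff_weak_star])
  then have "openin ?W (dual V N - q ` K)"
    by (metis B.topspace_weak_star closedin_def)
  moreover have "q x0 \<in> dual V N - q ` K"
  proof -
    have "y \<notin> K" if "q y = q x0" for y
      using U that orbit_closure_subset unfolding K_def Z_def by fastforce
    then show ?thesis using q_dual[OF x0] by auto
  qed
  moreover have "dual_dist V N (q x0) \<theta> < e"
    if \<theta>: "\<theta> \<in> dual V N - q ` K" "\<theta> \<in> dual_orbit V h (q x0)" for \<theta>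
  proof -
    \<comment> \<open>Since \<open>q x = q x0\<close>, the orbit may be run from \<open>x\<close>,
      which keeps it inside \<open>?C\<close>. The point lies in some \<open>U y\<close>, and
      \<open>q y\<close> is again \<open>q x0\<close>.\<close>
    obtain g where g: "\<theta> = q (act g x)"
      using \<theta>(2) dual_orbit_q[OF xX] qx by auto
    have gC: "act g x \<in> ?C" by (rule act_in_orbit_closure[OF xX])
    then obtain y where y: "y \<in> Z \<inter> ?C" "act g x \<in> U y"
      using \<theta>(1) g unfolding K_def by blast
    then have "\<rho> y (act g x) \<le> (e / 2)\<^sup>2" using U gC by blast
    then have "sqrt (\<rho> y (act g x)) \<le> e / 2" using e by (intro real_le_lsqrt) auto
    moreover have "y \<in> topspace X" "q y = q x0" using y(1) by (auto simp: Z_def)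
    ultimately show ?thesis
      using dual_dist_q_le[of y "act g x"] act_in[OF xX] e g by simp
  qed
  ultimately show thesis using that by blast
qed

theorem LE_matrix_coefficient_q:
  "LE_matrix_coefficient f V N h f (q (\<nu> 0))"
  unfolding LE_matrix_coefficient_def
proof (intro conjI ballI)
  show "apply_bcontfun f = matrix_coefficient h f (q (\<nu> 0))"
    by (auto simp: matrix_coefficient_def h_def f_V q_\<nu> tr_V tr_apply V_CX)
  fix \<phi> assume "\<phi> \<in> weak_star_orbit_closure V N h (q (\<nu> 0))"
  then obtain x where x: "x \<in> topspace X" "\<phi> = q x" using orbit_closure_dual_orbit by blast
  \<comment> \<open>An orbit is the orbit of each of its points, so the neighbourhood lemma, stated
    at a base point, applies at every point of the orbit.\<close>
  have orbit: "dual_orbit V h (q (act g x)) = dual_orbit V h (q x)" for g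
  proof -
    have "range (\<lambda>k. act k (act g x)) = range (\<lambda>k. act k x)"
    proof (intro equalityI subsetI; elim rangeE)
      show "y \<in> range (\<lambda>k. act k x)" if "y = act k (act g x)" for y k
        using that act_plus[OF x(1), of k g] by (metis rangeI)
      show "y \<in> range (\<lambda>k. act k (act g x))" if "y = act k x" for y k
        using that act_plus[OF x(1), of "k + - g" g] by (auto simp: add.assoc)
    qed
    then have "q ` range (\<lambda>k. act k (act g x)) = q ` range (\<lambda>k. act k x)"
      by simp
    then show ?thesis
      unfolding dual_orbit_q[OF x(1)] dual_orbit_q[OF act_in[OF x(1)]] image_image .
  qed
  show "subtopology (weak_star_topology V N) (dual_orbit V h \<phi>) =
      subtopology (dual_norm_topology V N) (dual_orbit V h \<phi>)"
  proof (subst B.weak_star_eq_norm_on_iff)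
    show "dual_orbit V h \<phi> \<subseteq> dual V N"
      using x q_dual act_in by (auto simp: dual_orbit_q)
    show "\<forall>\<theta>\<in>dual_orbit V h \<phi>. \<forall>e>0. \<exists>U. openin (weak_star_topology V N) U \<and> \<theta> \<in> U \<and>
       (\<forall>\<eta>\<in>U \<inter> dual_orbit V h \<phi>. dual_dist V N \<theta> \<eta> < e)"
    proof (intro ballI allI impI)
      fix \<theta> and e :: real assume "\<theta> \<in> dual_orbit V h \<phi>" and e: "e > 0"
      then obtain g where g: "\<theta> = q (act g x)" using x by (auto simp: dual_orbit_q)
      show "\<exists>U. openin (weak_star_topology V N) U \<and> \<theta> \<in> U \<and>
         (\<forall>\<eta>\<in>U \<inter> dual_orbit V h \<phi>. dual_dist V N \<theta> \<eta> < e)"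
        using norm_neighbourhood_on_orbit[OF act_in[OF x(1), of g] e]
        unfolding g x(2) orbit by (metis IntD1 IntD2)
    qed
  qed
qed (auto intro: banach_space_V co_representation_h f_V q_dual \<nu>_in)

text \<open>The orbit of \<open>q (\<nu> 0)\<close> consists of the evaluations at group elements,
  and members of \<open>V\<close> are functions on the group.\<close>

lemma separates_points_q: "separates_points (weak_star_orbit_closure V N h (q (\<nu> 0))) V"
  unfolding separates_points_def
proof (intro ballI impI)
  fix v w assume v: "v \<in> V" and w: "w \<in> V" and "v \<noteq> w"
  then obtain g where "apply_bcontfun v g \<noteq> apply_bcontfun w g" by (meson bcontfun_eqI)
  then have "q (\<nu> g) v \<noteq> q (\<nu> g) w" using v w by (simp add: q_\<nu>)
  moreover have "q (\<nu> g) \<in> weak_star_orbit_closure V N h (q (\<nu> 0))"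
  proof -
    have "dual_orbit V h (q (\<nu> 0)) \<subseteq> dual V N"
      using q_dual act_in \<nu>_in by (auto simp: dual_orbit_q)
    then have "dual_orbit V h (q (\<nu> 0)) \<subseteq> weak_star_orbit_closure V N h (q (\<nu> 0))"
      unfolding weak_star_orbit_closure_def by (intro closure_of_subset) simp
    moreover have "q (\<nu> g) \<in> dual_orbit V h (q (\<nu> 0))"
      using \<nu>_plus[of g 0] by (auto simp: dual_orbit_q \<nu>_in)
    ultimately show ?thesis by blast
  qed
  ultimately show "\<exists>\<phi>\<in>weak_star_orbit_closure V N h (q (\<nu> 0)). \<phi> v \<noteq> \<phi> w" by blast
qed

end

corollary LE_factorization_imp_LE_matrix_coefficient:
  fixes f :: "'g::topological_group_add \<Rightarrow>\<^sub>C real"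
  assumes "LE_factorization f X act \<nu> F"
  shows "\<exists>(V :: ('g \<Rightarrow>\<^sub>C real) set) N h v \<psi>. LE_matrix_coefficient f V N h v \<psi> \<and>
      separates_points (weak_star_orbit_closure V N h \<psi>) V"
proof -
  interpret LE_factor f X act \<nu> F by unfold_locales (rule assms)
  show ?thesis using LE_matrix_coefficient_q separates_points_q by blast
qed

(* The conjuncts: (1) iff (2); (1) iff (2) with Y separating the points of V; the types chosen to
   carry X in (1) and V in (2) lose no generality, as arbitrary types 'x and 'v would do. *)
theorem theorem9p10:
  fixes f :: "'g::topological_group_add \<Rightarrow>\<^sub>C real"
  shows
    "(f \<in> LE_functions \<longleftrightarrow>
       (\<exists>(V :: ('g \<Rightarrow>\<^sub>C real) set) N h v \<psi>. LE_matrix_coefficient f V N h v \<psi>)) \<and>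
     (f \<in> LE_functions \<longleftrightarrow>
       (\<exists>(V :: ('g \<Rightarrow>\<^sub>C real) set) N h v \<psi>. LE_matrix_coefficient f V N h v \<psi> \<and>
          separates_points (weak_star_orbit_closure V N h \<psi>) V)) \<and>
     ((\<exists>(X :: 'x topology) act \<nu> F. LE_factorization f X act \<nu> F) \<longrightarrow> f \<in> LE_functions) \<and>
     ((\<exists>(V :: 'v::real_vector set) N h v \<psi>. LE_matrix_coefficient f V N h v \<psi>) \<longrightarrow>
       f \<in> LE_functions)"
proof -
  let ?LE = "f \<in> LE_functions"
  have LE_I: ?LE if "LE_matrix_coefficient f V N h v \<psi>"
    for V :: "('g \<Rightarrow>\<^sub>C real) set" and N h v \<psi>
    unfolding LE_functions_def using LE_matrix_coefficient_imp_LE_factorization[OF that] by blast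
  have X: ?LE if "LE_factorization f X act \<nu> F" for X :: "'x topology" and act \<nu> F
    using LE_factorization_imp_LE_matrix_coefficient[OF that] LE_I by blast
  \<comment> \<open>Three passages: from \<open>V\<close> to a space of functionals on
    \<open>V\<close>, then to a subspace of C(G), then to a space of functionals on that.\<close>
  have V: ?LE if "LE_matrix_coefficient f V N h v \<psi>" for V :: "'v set" and N h v \<psi>
    using LE_factorization_imp_LE_matrix_coefficient[OF LE_matrix_coefficient_imp_LE_factorization[OF that]]
      LE_I by blast
  have sep: "\<exists>(V :: ('g \<Rightarrow>\<^sub>C real) set) N h v \<psi>. LE_matrix_coefficient f V N h v \<psi> \<and>
      separates_points (weak_star_orbit_closure V N h \<psi>) V" if ?LE
    using that LE_factorization_imp_LE_matrix_coefficient unfolding LE_functions_def by blast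
  show ?thesis
    by (intro conjI iffI impI; (elim exE conjE)?) (use sep LE_I X V in \<open>blast+\<close>)
qed

end
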